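(* Let $G$ be a bipartite graph and suppose that $V(G)=X\cup Y$ is a bipartition for the vertex set of $G$. Then for every positive integer $s$ with $s\leq \mathrm{match}(G)$, we have $$\mathrm{reg}\big(I(G)^{[s]}\big)\leq \min\{|X|, |Y|\}+s.$$
   Context: Let $\mathbb{K}$ be a field and $S=\mathbb{K}[x_1,\ldots,x_n]$ the standard graded polynomial ring. Graphs are finite and simple. For a graph $G$ with vertex set $V(G)=\{x_1,\ldots,x_n\}$ (vertices are identified with variables of $S$), the edge ideal is $I(G)=(x_ix_j : x_ix_j\in E(G))\subseteq S$. A matching is a set of pairwise disjoint edges, and $\mathrm{match}(G)$ is the maximum size of a matching of $G$. For a squarefree monomial ideal $I$, the $s$-th squarefree power $I^{[s]}$ is the ideal generated by the squarefree monomials belonging to $I^s$; thus $I(G)^{[s]}$ is generated by the products $e_1\cdots e_s$ with $\{e_1,\ldots,e_s\}$ a matching of $G$. For a finitely generated graded $S$-module $M$ with graded Betti numbers $\beta_{i,j}(M)$, the Castelnuovo--Mumford regularity is $\mathrm{reg}(M)=\max\{j-i : \beta_{i,j}(M)\neq 0\}$. *)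

theory Defs
  imports "HOL-Library.Poly_Mapping" "Jordan_Normal_Form.Matrix"
begin

section \<open>The standard graded polynomial ring\<close>

text \<open>A monomial is an exponent vector \<open>'v \<Rightarrow>\<^sub>0 nat\<close>. Multiplication of \<open>poly_mapping\<close>s is
  convolution, so for a finite type \<open>'v\<close> and a field \<open>'k\<close> the following type is the polynomial
  ring over \<open>'k\<close> with one variable for each element of \<open>'v\<close>.\<close>

type_synonym ('v, 'k) mpoly = "('v \<Rightarrow>\<^sub>0 nat) \<Rightarrow>\<^sub>0 'k"

definition Var :: "'v \<Rightarrow> ('v, 'k::field) mpoly" where
  "Var x = Poly_Mapping.single (Poly_Mapping.single x 1) 1"

definition mon_degree :: "('v::finite \<Rightarrow>\<^sub>0 nat) \<Rightarrow> nat" where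
  "mon_degree m = (\<Sum>x\<in>UNIV. Poly_Mapping.lookup m x)"

text \<open>Degrees are integers, since differences of shifts occur below. The zero polynomial is
  homogeneous of every degree, and the only homogeneous polynomial of negative degree.\<close>

definition homogeneous :: "int \<Rightarrow> ('v::finite, 'k::field) mpoly \<Rightarrow> bool" where
  "homogeneous d f \<longleftrightarrow> (\<forall>m \<in> Poly_Mapping.keys f. int (mon_degree m) = d)"

section \<open>Ideals and squarefree powers\<close>

text \<open>Ideals of a commutative ring are its submodules under left multiplication.\<close>

lemma module_times: "Modules.module ((*) :: 'a::comm_ring_1 \<Rightarrow> 'a \<Rightarrow> 'a)"
  by standard (simp_all add: algebra_simps)

definition ideal_gen :: "'a::comm_ring_1 set \<Rightarrow> 'a set" where
  "ideal_gen B = Modules.module.span (*) B"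

fun ideal_power :: "'a::comm_ring_1 set \<Rightarrow> nat \<Rightarrow> 'a set" where
  "ideal_power I 0 = UNIV"
| "ideal_power I (Suc s) = ideal_gen {a * b | a b. a \<in> I \<and> b \<in> ideal_power I s}"

definition squarefree_monomial :: "('v, 'k::field) mpoly \<Rightarrow> bool" where
  "squarefree_monomial f \<longleftrightarrow>
     (\<exists>m. f = Poly_Mapping.single m 1 \<and> (\<forall>x. Poly_Mapping.lookup m x \<le> 1))"

definition squarefree_power :: "('v, 'k::field) mpoly set \<Rightarrow> nat \<Rightarrow> ('v, 'k) mpoly set" where
  "squarefree_power I s = ideal_gen {f \<in> ideal_power I s. squarefree_monomial f}"

section \<open>Minimal graded free resolutions and regularity\<close>

text \<open>Throughout, \<open>smul\<close> is an action of \<open>S = ('v, 'k) mpoly\<close> on \<open>'m\<close>, \<open>M\<close> is a finitely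
  generated \<open>S\<close>-submodule of \<open>'m\<close>, and \<open>gr j\<close> is the component of degree \<open>j\<close> of a grading of
  \<open>M\<close>. The data below describe a complex
  \<open>\<dots> \<rightarrow> F\<^sub>2 \<rightarrow> F\<^sub>1 \<rightarrow> F\<^sub>0 \<rightarrow> M\<close>:
  \<open>F\<^sub>i\<close> is the direct sum of the modules \<open>S(-e)\<close> over the entries \<open>e\<close> of the list
  \<open>shifts R i\<close> (so its \<open>l\<close>-th basis vector has degree \<open>shifts R i ! l\<close>), \<open>differential R i\<close> is the
  matrix of \<open>F\<^bsub>i+1\<^esub> \<rightarrow> F\<^sub>i\<close>, and \<open>gens R\<close> lists the images in \<open>M\<close> of the basis vectors of \<open>F\<^sub>0\<close>.\<close>

record (overloaded) ('v, 'k, 'm) graded_complex =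
  shifts :: "nat \<Rightarrow> int list"
  gens :: "'m list"
  differential :: "nat \<Rightarrow> ('v, 'k) mpoly mat"

definition free_mod :: "('v, 'k::field, 'm) graded_complex \<Rightarrow> nat \<Rightarrow> ('v, 'k) mpoly vec set" where
  "free_mod R i = carrier_vec (length (shifts R i))"

definition augmentation ::
    "(('v, 'k::field) mpoly \<Rightarrow> 'm \<Rightarrow> 'm::ab_group_add) \<Rightarrow> ('v, 'k, 'm) graded_complex \<Rightarrow>
     ('v, 'k) mpoly vec \<Rightarrow> 'm" where
  "augmentation smul R v = (\<Sum>l<length (gens R). smul (v $ l) (gens R ! l))"

text \<open>\<open>F\<^sub>i \<rightarrow> F\<^bsub>i-1\<^esub>\<close> (with \<open>M\<close> in place of \<open>F\<^bsub>-1\<^esub>\<close>) is homogeneous of degree 0.\<close>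

definition is_graded_complex ::
    "(int \<Rightarrow> 'm set) \<Rightarrow> ('v::finite, 'k::field, 'm) graded_complex \<Rightarrow> bool" where
  "is_graded_complex gr R \<longleftrightarrow>
     length (gens R) = length (shifts R 0) \<and>
     (\<forall>l < length (gens R). gens R ! l \<in> gr (shifts R 0 ! l)) \<and>
     (\<forall>i. differential R i \<in> carrier_mat (length (shifts R i)) (length (shifts R (Suc i))) \<and>
        (\<forall>l < length (shifts R i). \<forall>k < length (shifts R (Suc i)).
           homogeneous (shifts R (Suc i) ! k - shifts R i ! l) (differential R i $$ (l, k))))"

definition graded_free_resolution ::
    "(('v::finite, 'k::field) mpoly \<Rightarrow> 'm \<Rightarrow> 'm::ab_group_add) \<Rightarrow> 'm set \<Rightarrow> (int \<Rightarrow> 'm set) \<Rightarrow>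
     ('v, 'k, 'm) graded_complex \<Rightarrow> bool" where
  "graded_free_resolution smul M gr R \<longleftrightarrow>
     is_graded_complex gr R \<and>
     augmentation smul R ` free_mod R 0 = M \<and>
     (*\<^sub>v) (differential R 0) ` free_mod R 1 = {v \<in> free_mod R 0. augmentation smul R v = 0} \<and>
     (\<forall>i. (*\<^sub>v) (differential R (Suc i)) ` free_mod R (Suc (Suc i)) =
          {v \<in> free_mod R (Suc i). differential R i *\<^sub>v v = 0\<^sub>v (length (shifts R i))})"

text \<open>Minimality: the image of \<open>F\<^bsub>i+1\<^esub>\<close> lies in \<open>\<mm> F\<^sub>i\<close>, where \<open>\<mm>\<close> is the ideal generated by
  the variables.\<close>

definition minimal_graded_free_resolution ::
    "(('v::finite, 'k::field) mpoly \<Rightarrow> 'm \<Rightarrow> 'm::ab_group_add) \<Rightarrow> 'm set \<Rightarrow> (int \<Rightarrow> 'm set) \<Rightarrow>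
     ('v, 'k, 'm) graded_complex \<Rightarrow> bool" where
  "minimal_graded_free_resolution smul M gr R \<longleftrightarrow>
     graded_free_resolution smul M gr R \<and>
     (\<forall>i. \<forall>l < length (shifts R i). \<forall>k < length (shifts R (Suc i)).
        differential R i $$ (l, k) \<in> ideal_gen (range Var))"

text \<open>A minimal graded free resolution of \<open>M\<close> exists and is unique up to isomorphism of graded
  complexes, so the choice below is immaterial.\<close>

definition graded_betti ::
    "(('v::finite, 'k::field) mpoly \<Rightarrow> 'm \<Rightarrow> 'm::ab_group_add) \<Rightarrow> 'm set \<Rightarrow> (int \<Rightarrow> 'm set) \<Rightarrow>
     nat \<Rightarrow> int \<Rightarrow> nat" where
  "graded_betti smul M gr i j =
     count_list (shifts (SOME R. minimal_graded_free_resolution smul M gr R) i) j"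

definition regularity ::
    "(('v::finite, 'k::field) mpoly \<Rightarrow> 'm \<Rightarrow> 'm::ab_group_add) \<Rightarrow> 'm set \<Rightarrow> (int \<Rightarrow> 'm set) \<Rightarrow> int"
  where
  "regularity smul M gr = Max {j - int i | i j. graded_betti smul M gr i j \<noteq> 0}"

text \<open>The regularity of a nonzero homogeneous ideal, as a graded submodule of \<open>S\<close>.\<close>

definition ideal_reg :: "('v::finite, 'k::field) mpoly set \<Rightarrow> int" where
  "ideal_reg I = regularity (*) I (\<lambda>j. {f \<in> I. homogeneous j f})"

section \<open>Graphs\<close>

text \<open>A graph has vertex set \<open>UNIV :: 'v set\<close> for a finite type \<open>'v\<close>, and is given by its set of
  edges.\<close>

definition simple_graph :: "'v::finite set set \<Rightarrow> bool" where
  "simple_graph E \<longleftrightarrow> (\<forall>e\<in>E. card e = 2)"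

definition bipartition :: "'v::finite set set \<Rightarrow> 'v set \<Rightarrow> 'v set \<Rightarrow> bool" where
  "bipartition E X Y \<longleftrightarrow>
     X \<union> Y = UNIV \<and> X \<inter> Y = {} \<and> (\<forall>e\<in>E. \<exists>x\<in>X. \<exists>y\<in>Y. e = {x, y})"

definition matching :: "'v::finite set set \<Rightarrow> 'v set set \<Rightarrow> bool" where
  "matching E M \<longleftrightarrow> M \<subseteq> E \<and> pairwise disjnt M"

definition matching_number :: "'v::finite set set \<Rightarrow> nat" where
  "matching_number E = Max {card M | M. matching E M}"

definition edge_ideal :: "'v::finite set set \<Rightarrow> ('v, 'k::field) mpoly set" where
  "edge_ideal E = ideal_gen {Var x * Var y | x y. {x, y} \<in> E}"

end

theory Submission
  imports Defs "HOL-Library.Function_Algebras"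
begin

text \<open>
  A graded module \<open>N\<close> is said to have Tor bound \<open>d\<close> if its Koszul homology in position \<open>i\<close> vanishes in
  all degrees \<open>> i + d\<close>. This passes from \<open>N\<close> to the kernel of a graded surjection \<open>F \<rightarrow> N\<close> with \<open>F\<close>
  free on generators of degree \<open>\<le> d\<close>, with \<open>d + 1\<close> in place of \<open>d\<close>, and position \<open>0\<close> says that \<open>N\<close> is
  generated in degrees \<open>\<le> d\<close>. Hence a minimal resolution exists, and in every minimal resolution the
  shifts at step \<open>i\<close> are at most \<open>i + d\<close>.

  For a monomial ideal the Koszul homology splits over the multidegrees \<open>a\<close> into reduced simplicial
  homology. For \<open>I(G)\<^bsup>[s]\<^esup>\<close> only squarefree \<open>a\<close> contribute. The subsets of \<open>Y\<close> that can be matched into a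
  fixed subset of \<open>X\<close> are the independent sets of a transversal matroid, and deletion and contraction
  show that, with respect to the variables in \<open>Y\<close>, homology in position \<open>i\<close> vanishes if \<open>a\<close> involves more
  than \<open>i + s\<close> variables of \<open>Y\<close>. Adding the variables in \<open>X\<close> one at a time preserves this bound. As \<open>a\<close> involves
  at most \<open>|X|\<close> variables of \<open>X\<close>, the ideal has Tor bound \<open>|X| + s\<close>, and by symmetry \<open>|Y| + s\<close>.
\<close>

section \<open>Koszul complexes and simplicial homology\<close>

text \<open>\<open>regularity\<close> speaks of one resolution picked by \<open>SOME\<close>, so a
  vanishing statement about Koszul homology says nothing until it is tied to that resolution. This
  is done by following the bound through the successive syzygies of an arbitrary minimal resolution.
  \<open>SOME\<close> also requires existence, and \<open>Max\<close> requires a finite nonempty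
  set; finiteness comes from the strict growth of the least shift.

  The constant \<open>s\<close> has a matroid origin. For a fixed set of partners in
  \<open>X\<close>, the faces are the sets of \<open>Y\<close>-vertices whose complement still
  contains a matchable set of size \<open>s\<close>. They are the independent sets of the dual of
  the transversal matroid truncated to rank \<open>s\<close>. If there are \<open>n\<close> such
  vertices and the complex is not void, this dual has rank \<open>n - s\<close>, and a matroid
  complex has reduced homology only in its top dimension. So positions \<open>i\<close> with
  \<open>i + s < n\<close> are acyclic. A vertex of \<open>X\<close> in the multidegree only decides
  which partners remain available; the count of \<open>Y\<close>-vertices is untouched. Hence each
  such vertex may raise the degree by one without changing the position.\<close>

definition vpos :: "'v::finite \<Rightarrow> nat" where
  "vpos = (SOME f. inj f)"

lemma inj_vpos: "inj (vpos :: 'v::finite \<Rightarrow> nat)"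
proof -
  have "\<exists>f :: 'v \<Rightarrow> nat. inj f" using finite_imp_inj_to_nat_seg[OF finite_UNIV] by blast
  then show ?thesis unfolding vpos_def by (rule someI_ex)
qed

text \<open>The sign that moves \<open>e_z\<close> to its place in the exterior monomial of
  \<open>insert z A\<close>, for the order given by \<open>vpos\<close>. As a case distinction
  rather than a scalar factor it makes sense in any abelian group, so polynomials, vectors and field
  elements share one differential.\<close>

definition ksign :: "'v::finite \<Rightarrow> 'v set \<Rightarrow> 'm::ab_group_add \<Rightarrow> 'm" where
  "ksign z A v = (if even (card {w\<in>A. vpos w < vpos z}) then v else - v)"

lemma ksign_add: "ksign z A (v + w) = ksign z A v + ksign z A w"
  and ksign_minus: "ksign z A (- v) = - ksign z A v"
  and ksign_zero [simp]: "ksign z A 0 = 0"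
  and ksign_ksign [simp]: "ksign z A (ksign z A v) = v"
  and ksign_eq_0 [simp]: "ksign z A v = 0 \<longleftrightarrow> v = 0"
  by (auto simp: ksign_def)

lemma ksign_sum: "ksign z A (sum f S) = (\<Sum>x\<in>S. ksign z A (f x))"
  by (simp add: ksign_def sum_negf)

lemma card_insert_less:
  fixes x z :: "'v::finite"
  assumes "z \<notin> A"
  shows "card {w\<in>insert z A. vpos w < vpos x} = card {w\<in>A. vpos w < vpos x} + (if vpos z < vpos x then 1 else 0)"
proof -
  have "{w\<in>insert z A. vpos w < vpos x} =
    (if vpos z < vpos x then insert z {w\<in>A. vpos w < vpos x} else {w\<in>A. vpos w < vpos x})"
    by auto
  then show ?thesis using assms by simp
qed

text \<open>Of \<open>x\<close> and \<open>z\<close> exactly one precedes the other, so exactly one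
  of the two counts grows by one when the other element is added.\<close>

lemma ksign_exchange:
  assumes "x \<noteq> z" "x \<notin> A" "z \<notin> A"
  shows "ksign z (insert x A) (ksign x (insert z A) v) = - ksign x A (ksign z A v)"
proof -
  have "vpos z < vpos x \<longleftrightarrow> \<not> vpos x < vpos z"
    using assms(1) inj_vpos[THEN injD, of x z] by fastforce
  then show ?thesis
    unfolding ksign_def card_insert_less[OF assms(2)] card_insert_less[OF assms(3)] by auto
qed

lemma ksign_antisym:
  assumes "x \<noteq> z" "x \<notin> A" "z \<notin> A"
  shows "ksign z A (ksign x (insert z A) v) = - ksign x A (ksign z (insert x A) v)"
proof -
  have "ksign z A (ksign x (insert z A) v)
      = ksign z A (ksign z (insert x A) (ksign z (insert x A) (ksign x (insert z A) v)))"
    by simp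
  also have "\<dots> = ksign z A (ksign z (insert x A) (- ksign x A (ksign z A v)))"
    using ksign_exchange[OF assms] by metis
  also have "\<dots> = - ksign x A (ksign z (insert x A) v)"
    by (simp add: ksign_def)
  finally show ?thesis .
qed

section \<open>The Koszul differential\<close>

text \<open>\<open>c A\<close> is the coefficient of the basis element \<open>e\<^sub>A\<close> of the exterior algebra on the variables.\<close>

definition kd :: "('v::finite \<Rightarrow> 'm \<Rightarrow> 'm) \<Rightarrow> ('v set \<Rightarrow> 'm) \<Rightarrow> 'v set \<Rightarrow> 'm::ab_group_add" where
  "kd act c A = (\<Sum>z\<in>-A. ksign z A (act z (c (insert z A))))"

locale commuting_action =
  fixes act :: "'v::finite \<Rightarrow> 'm::ab_group_add \<Rightarrow> 'm"
  assumes act_add: "\<And>z v w. act z (v + w) = act z v + act z w"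
    and act_commute: "\<And>z w v. act z (act w v) = act w (act z v)"
begin

lemma act_zero: "act z 0 = 0"
  using act_add[of z 0 0] by simp

lemma act_minus: "act z (- v) = - act z v"
  using act_add[of z v "- v"] act_zero by (simp add: eq_neg_iff_add_eq_0 add.commute)

lemma act_sum: "act z (sum f S) = (\<Sum>x\<in>S. act z (f x))"
  by (induction S rule: infinite_finite_induct) (auto simp: act_add act_zero)

lemma act_ksign: "act z (ksign x A v) = ksign x A (act z v)"
  by (simp add: ksign_def act_minus)

lemma kd_add: "kd act (\<lambda>A. b A + c A) A = kd act b A + kd act c A"
  by (simp add: kd_def act_add ksign_add sum.distrib)

lemma kd_minus: "kd act (\<lambda>A. - c A) A = - kd act c A"
  by (simp add: kd_def act_minus ksign_minus sum_negf)

lemma kd_diff: "kd act (\<lambda>A. b A - c A) A = kd act b A - kd act c A"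
  using kd_add[of b "\<lambda>A. - c A" A] by (simp add: kd_minus)

text \<open>Exchanging the two indices would only show that the sum equals its own negative, which
  does not make it zero in characteristic 2. The induction cancels \<open>T z x\<close> against
  \<open>T x z\<close> pair by pair.\<close>

lemma sum_antisym:
  fixes T :: "'a \<Rightarrow> 'a \<Rightarrow> 'm"
  assumes "finite S" "\<And>z w. z \<in> S \<Longrightarrow> w \<in> S \<Longrightarrow> z \<noteq> w \<Longrightarrow> T z w = - T w z"
  shows "(\<Sum>z\<in>S. \<Sum>w\<in>S - {z}. T z w) = 0"
  using assms
proof (induction S)
  case (insert x S)
  have "(\<Sum>z\<in>S. \<Sum>w\<in>insert x S - {z}. T z w) = (\<Sum>z\<in>S. T z x + (\<Sum>w\<in>S - {z}. T z w))"
  proof (rule sum.cong[OF refl])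
    fix z assume "z \<in> S"
    then have "insert x S - {z} = insert x (S - {z})" "x \<notin> S - {z}" using insert.hyps by auto
    then show "(\<Sum>w\<in>insert x S - {z}. T z w) = T z x + (\<Sum>w\<in>S - {z}. T z w)"
      using insert.hyps(1) by simp
  qed
  also have "\<dots> = (\<Sum>z\<in>S. T z x) + (\<Sum>z\<in>S. \<Sum>w\<in>S - {z}. T z w)"
    by (rule sum.distrib)
  also have "(\<Sum>z\<in>S. \<Sum>w\<in>S - {z}. T z w) = 0"
    by (rule insert.IH) (rule insert.prems; simp)
  also have "(\<Sum>z\<in>S. T z x) = (\<Sum>z\<in>S. - T x z)"
    using insert.hyps(2) by (intro sum.cong refl insert.prems) auto
  finally have "(\<Sum>z\<in>S. \<Sum>w\<in>insert x S - {z}. T z w) = - (\<Sum>w\<in>S. T x w)"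
    by (simp add: sum_negf)
  then show ?case using insert.hyps by simp
qed simp

lemma kd_kd: "kd act (kd act c) A = 0"
proof -
  define T where "T z w = ksign z A (ksign w (insert z A) (act z (act w (c (insert w (insert z A))))))" for z w
  have "kd act (kd act c) A = (\<Sum>z\<in>-A. \<Sum>w\<in>-A - {z}. T z w)"
    unfolding kd_def T_def
    by (intro sum.cong) (auto simp: act_sum ksign_sum act_ksign intro!: sum.cong)
  also have "\<dots> = 0"
  proof (rule sum_antisym)
    fix z w assume "z \<in> - A" "w \<in> - A" "z \<noteq> w"
    then show "T z w = - T w z"
      unfolding T_def insert_commute[of w z] act_commute[of z w]
      by (intro ksign_antisym) auto
  qed simp
  finally show ?thesis .
qed

end

text \<open>Position \<open>i\<close> and internal degree \<open>j\<close> of the Koszul complex: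
  \<open>e_A\<close> has degree \<open>card A\<close>, so its coefficient has degree
  \<open>j - int (card A)\<close>. In position 0 the condition says that \<open>gr j\<close>
  consists of combinations of variables times elements of \<open>gr (j - 1)\<close>.\<close>

definition exact_at :: "('v::finite \<Rightarrow> 'm \<Rightarrow> 'm) \<Rightarrow> (int \<Rightarrow> 'm::ab_group_add set) \<Rightarrow> nat \<Rightarrow> int \<Rightarrow> bool" where
  "exact_at act gr i j \<longleftrightarrow>
     (\<forall>c. (\<forall>A. c A \<in> gr (j - int (card A))) \<and> (\<forall>A. card A \<noteq> i \<longrightarrow> c A = 0) \<and> (\<forall>A. kd act c A = 0) \<longrightarrow>
        (\<exists>b. (\<forall>A. b A \<in> gr (j - int (card A))) \<and> (\<forall>A. card A \<noteq> Suc i \<longrightarrow> b A = 0) \<and> (\<forall>A. kd act b A = c A)))"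

text \<open>The stretch of the long exact sequence of \<open>0 -> ker phi -> F -> N -> 0\<close> in
  which position \<open>i\<close> of the kernel lies between position \<open>Suc i\<close> of
  \<open>N\<close> and position \<open>i\<close> of \<open>F\<close>. In the diagram chase, a
  filling in \<open>F\<close> is corrected by the boundary of a lift so that it falls into the
  kernel.\<close>

lemma exact_at_kernel:
  fixes phi :: "'a::ab_group_add \<Rightarrow> 'm::ab_group_add"
  assumes act: "commuting_action act" and act': "commuting_action act'"
    and phi_add: "\<And>v w. phi (v + w) = phi v + phi w"
    and phi_act: "\<And>z v. phi (act z v) = act' z (phi v)"
    and image: "\<And>j. phi ` F j = N j"
    and zero: "\<And>j. 0 \<in> F j" and diff: "\<And>j v w. v \<in> F j \<Longrightarrow> w \<in> F j \<Longrightarrow> v - w \<in> F j"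
    and act_F: "\<And>j z v. v \<in> F (j - 1) \<Longrightarrow> act z v \<in> F j"
    and exF: "exact_at act F i j"
    and exN: "exact_at act' N (Suc i) j"
  shows "exact_at act (\<lambda>j. {v \<in> F j. phi v = 0}) i j"
  unfolding exact_at_def
proof (intro allI impI, elim conjE)
  interpret a: commuting_action act by fact
  interpret a': commuting_action act' by fact
  have phi0: "phi 0 = 0" using phi_add[of 0 0] by simp
  have phi_minus: "phi (- v) = - phi v" for v
    using phi_add[of v "- v"] phi0 by (simp add: eq_neg_iff_add_eq_0 add.commute)
  have phi_diff: "phi (v - w) = phi v - phi w" for v w
    using phi_add[of v "- w"] phi_minus by simp
  have phi_sum: "phi (sum f S) = (\<Sum>x\<in>S. phi (f x))" for f and S :: "'b set"
    by (induction S rule: infinite_finite_induct) (auto simp: phi_add phi0)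
  have phi_kd: "phi (kd act b A) = kd act' (\<lambda>A. phi (b A)) A" for b A
    unfolding kd_def phi_sum by (intro sum.cong) (auto simp: ksign_def phi_minus phi_act)
  have minus: "- v \<in> F j" if "v \<in> F j" for v j
    using diff[OF zero that] by simp
  have add: "v + w \<in> F j" if "v \<in> F j" "w \<in> F j" for v w j
    using diff[OF that(1) minus[OF that(2)]] by simp
  have sumF: "(\<Sum>x\<in>S. f x) \<in> F j" if "\<And>x. x \<in> S \<Longrightarrow> f x \<in> F j" for f j and S :: "'b set"
    using that by (induction S rule: infinite_finite_induct) (auto simp: zero add)
  fix c :: "'b set \<Rightarrow> 'a"
  assume c: "\<forall>A. c A \<in> {v \<in> F (j - int (card A)). phi v = 0}"
    "\<forall>A. card A \<noteq> i \<longrightarrow> c A = 0" "\<forall>A. kd act c A = 0"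
  obtain b where b: "\<forall>A. b A \<in> F (j - int (card A))" "\<forall>A. card A \<noteq> Suc i \<longrightarrow> b A = 0" "\<forall>A. kd act b A = c A"
    using exF c unfolding exact_at_def by blast
  have "(\<forall>A. phi (b A) \<in> N (j - int (card A))) \<and> (\<forall>A. card A \<noteq> Suc i \<longrightarrow> phi (b A) = 0)
      \<and> (\<forall>A. kd act' (\<lambda>A. phi (b A)) A = 0)"
  proof (intro conjI allI impI)
    fix A
    show "phi (b A) \<in> N (j - int (card A))" using b(1) image by blast
    show "phi (b A) = 0" if "card A \<noteq> Suc i" using that b(2) phi0 by simp
    show "kd act' (\<lambda>A. phi (b A)) A = 0"
      using c(1) b(3) by (simp flip: phi_kd)
  qed
  then obtain e where e: "\<forall>A. e A \<in> N (j - int (card A))"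
    "\<forall>A. card A \<noteq> Suc (Suc i) \<longrightarrow> e A = 0" "\<forall>A. kd act' e A = phi (b A)"
    using exN[unfolded exact_at_def, THEN spec, of "\<lambda>A. phi (b A)"] by blast
  \<comment> \<open>The lift of \<open>e\<close> is chosen to be 0 off the sets of size
    \<open>Suc (Suc i)\<close>; otherwise its boundary could leave position
    \<open>Suc i\<close>.\<close>
  have "\<forall>A. \<exists>f. f \<in> F (j - int (card A)) \<and> phi f = e A \<and> (card A \<noteq> Suc (Suc i) \<longrightarrow> f = 0)"
  proof
    fix A show "\<exists>f. f \<in> F (j - int (card A)) \<and> phi f = e A \<and> (card A \<noteq> Suc (Suc i) \<longrightarrow> f = 0)"
    proof (cases "card A = Suc (Suc i)")
      case True
      have "e A \<in> phi ` F (j - int (card A))" using e(1) image by blast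
      then show ?thesis using True by auto
    next
      case False
      then show ?thesis using e(2) zero phi0 by auto
    qed
  qed
  then obtain f where f: "\<And>A. f A \<in> F (j - int (card A))" "\<And>A. phi (f A) = e A"
    "\<And>A. card A \<noteq> Suc (Suc i) \<Longrightarrow> f A = 0"
    by metis
  have kdF: "kd act f A \<in> F (j - int (card A))" for A
    unfolding kd_def
  proof (rule sumF)
    fix x assume "x \<in> - A"
    then have "act x (f (insert x A)) \<in> F (j - int (card A))"
      using f(1)[of "insert x A"] by (intro act_F) (simp add: algebra_simps)
    then show "ksign x A (act x (f (insert x A))) \<in> F (j - int (card A))"
      by (simp add: ksign_def minus)
  qed
  have kdf0: "kd act f A = 0" if "card A \<noteq> Suc i" for A
    unfolding kd_def using that f(3) by (intro sum.neutral) (auto simp: a.act_zero)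
  define b' where "b' = (\<lambda>A. b A - kd act f A)"
  show "\<exists>b. (\<forall>A. b A \<in> {v \<in> F (j - int (card A)). phi v = 0}) \<and> (\<forall>A. card A \<noteq> Suc i \<longrightarrow> b A = 0) \<and> (\<forall>A. kd act b A = c A)"
  proof (intro exI conjI allI impI)
    fix A
    have "phi (b' A) = 0"
      unfolding b'_def phi_diff phi_kd f(2) using e(3) by simp
    then show "b' A \<in> {v \<in> F (j - int (card A)). phi v = 0}"
      unfolding b'_def using b(1) kdF diff by auto
    have "kd act b' A = kd act b A - kd act (kd act f) A"
      unfolding b'_def by (rule a.kd_diff)
    then show "kd act b' A = c A"
      unfolding a.kd_kd b(3)[rule_format] by simp
    show "b' A = 0" if "card A \<noteq> Suc i"
      using that b(2) kdf0 by (simp add: b'_def)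
  qed
qed

section \<open>Reduced homology: cones, deletions and links\<close>

text \<open>Sets of cardinality \<open>i\<close> are faces of dimension \<open>i - 1\<close>, so this is the vanishing of reduced homology
  in dimension \<open>i - 1\<close>.\<close>

definition acyclic_at :: "'k::field itself \<Rightarrow> 'v::finite set set \<Rightarrow> nat \<Rightarrow> bool" where
  "acyclic_at (_ :: 'k itself) D i \<longleftrightarrow>
     (\<forall>c :: 'v set \<Rightarrow> 'k. (\<forall>A. c A \<noteq> 0 \<longrightarrow> A \<in> D \<and> card A = i) \<and> (\<forall>A. kd (\<lambda>z v. v) c A = 0) \<longrightarrow>
       (\<exists>b. (\<forall>A. b A \<noteq> 0 \<longrightarrow> A \<in> D \<and> card A = Suc i) \<and> (\<forall>A. kd (\<lambda>z v. v) b A = c A)))"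

lemma commuting_action_triv: "commuting_action (\<lambda>z v. v)"
  by (simp add: commuting_action_def)

lemmas triv_kd_add = commuting_action.kd_add[OF commuting_action_triv]
lemmas triv_kd_diff = commuting_action.kd_diff[OF commuting_action_triv]
lemmas triv_kd_kd = commuting_action.kd_kd[OF commuting_action_triv]

lemma kd_cone:
  assumes "\<And>A. x \<notin> A \<Longrightarrow> b A = 0" "x \<notin> A"
  shows "kd (\<lambda>z v. v) b A = ksign x A (b (insert x A))"
proof -
  have "kd (\<lambda>z v. v) b A = (\<Sum>z\<in>-A. if z = x then ksign x A (b (insert x A)) else 0)"
    unfolding kd_def using assms by (intro sum.cong) auto
  then show ?thesis using assms by simp
qed

text \<open>Coning the part of \<open>c\<close> that avoids \<open>x\<close> gives \<open>b\<close>,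
  and \<open>c - kd b\<close> then vanishes on all sets without \<open>x\<close>. As it is a cycle,
  it vanishes on the sets with \<open>x\<close> too, because by \<open>kd_cone\<close> its boundary
  at a set without \<open>x\<close> has a single term.\<close>

lemma acyclic_at_cone:
  assumes "\<And>A. A \<in> D \<Longrightarrow> insert x A \<in> D"
  shows "acyclic_at TYPE('k::field) D i"
  unfolding acyclic_at_def
proof (intro allI impI, elim conjE)
  fix c :: "'a set \<Rightarrow> 'k"
  assume c: "\<forall>A. c A \<noteq> 0 \<longrightarrow> A \<in> D \<and> card A = i" "\<forall>A. kd (\<lambda>z v. v) c A = 0"
  define b where "b = (\<lambda>A. (if x \<in> A then ksign x (A - {x}) (c (A - {x})) else 0))"
  define c' where "c' = (\<lambda>A. c A - kd (\<lambda>z v. v) b A)"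
  have c'0: "c' A = 0" if "x \<notin> A" for A
    using kd_cone[of x b A] that by (simp add: c'_def b_def)
  have "kd (\<lambda>z v. v) c' A = 0" for A
    unfolding c'_def triv_kd_diff triv_kd_kd using c(2) by simp
  then have c'1: "c' (insert x A) = 0" if "x \<notin> A" for A
    using kd_cone[of x c' A] c'0 that by simp
  have "c' A = 0" for A
  proof (cases "x \<in> A")
    case True
    then show ?thesis using c'1[of "A - {x}"] by (simp add: insert_absorb)
  qed (rule c'0)
  then have "kd (\<lambda>z v. v) b A = c A" for A by (simp add: c'_def)
  moreover have "A \<in> D \<and> card A = Suc i" if "b A \<noteq> 0" for A
  proof -
    have x: "x \<in> A" and "c (A - {x}) \<noteq> 0" using that by (auto simp: b_def split: if_splits)
    then have "A - {x} \<in> D" "card (A - {x}) = i" using c(1) by auto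
    with x assms[of "A - {x}"] card_Suc_Diff1[of A x] show ?thesis
      by (simp add: insert_absorb)
  qed
  ultimately show "\<exists>b. (\<forall>A. b A \<noteq> 0 \<longrightarrow> A \<in> D \<and> card A = Suc i) \<and> (\<forall>A. kd (\<lambda>z v. v) b A = c A)"
    by blast
qed

text \<open>The homology sequence for the cover of \<open>D\<close> by the deletion of
  \<open>x\<close> and the cone over the link of \<open>x\<close>. The faces of a cycle through
  \<open>x\<close> form a cycle of the link, one position lower. A filling there, coned back with
  \<open>x\<close>, moves the cycle into the deletion up to a boundary.\<close>

lemma acyclic_at_deletion_link:
  assumes down: "\<And>A. insert x A \<in> D \<Longrightarrow> A \<in> D"
    and del: "acyclic_at TYPE('k::field) {A \<in> D. x \<notin> A} i"
    and link: "\<And>i'. i = Suc i' \<Longrightarrow> acyclic_at TYPE('k) {A. x \<notin> A \<and> insert x A \<in> D} i'"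
  shows "acyclic_at TYPE('k) D i"
  unfolding acyclic_at_def
proof (intro allI impI, elim conjE)
  let ?kd = "kd (\<lambda>z v :: 'k. v)"
  fix c :: "'a set \<Rightarrow> 'k"
  assume c: "\<forall>A. c A \<noteq> 0 \<longrightarrow> A \<in> D \<and> card A = i" "\<forall>A. ?kd c A = 0"
  have "\<exists>b'. (\<forall>A. b' A \<noteq> 0 \<longrightarrow> A \<in> D \<and> card A = Suc i) \<and> (\<forall>A. x \<in> A \<longrightarrow> ?kd b' A = c A)
     \<and> (\<forall>A. ?kd b' A \<noteq> 0 \<longrightarrow> A \<in> D \<and> card A = i)"
  proof (cases i)
    \<comment> \<open>In position 0 the only possible face is the empty set, so nothing has to be
      moved off \<open>x\<close>.\<close>
    case 0
    then have "c A = 0" if "x \<in> A" for A using c(1) that by auto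
    then show ?thesis by (intro exI[of _ "\<lambda>A. 0"]) (auto simp: kd_def)
  next
    case (Suc i')
    define c1 where "c1 = (\<lambda>A. (if x \<in> A then 0 else ksign x A (c (insert x A))))"
    have "A \<in> {A. x \<notin> A \<and> insert x A \<in> D} \<and> card A = i'" if "c1 A \<noteq> 0" for A
    proof -
      have "x \<notin> A" "c (insert x A) \<noteq> 0" using that by (auto simp: c1_def split: if_splits)
      then show ?thesis using c(1) Suc by force
    qed
    moreover have "?kd c1 A = 0" for A
    proof (cases "x \<in> A")
      case True
      then show ?thesis by (simp add: kd_def c1_def)
    next
      case False
      have "?kd c1 A = (\<Sum>z\<in>insert x (- insert x A). ksign z A (c1 (insert z A)))"
        unfolding kd_def using False by (intro sum.cong) auto
      also have "\<dots> = (\<Sum>z\<in>-insert x A. ksign z A (c1 (insert z A)))"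
        by (simp add: c1_def)
      also have "\<dots> = (\<Sum>z\<in>-insert x A. - ksign x A (ksign z (insert x A) (c (insert z (insert x A)))))"
        using False ksign_antisym[of x _ A]
        by (intro sum.cong) (auto simp: c1_def insert_commute)
      also have "\<dots> = - ksign x A (?kd c (insert x A))"
        by (simp add: kd_def ksign_sum sum_negf)
      finally show ?thesis using c(2) by simp
    qed
    ultimately obtain b1 where b1: "\<forall>A. b1 A \<noteq> 0 \<longrightarrow> A \<in> {A. x \<notin> A \<and> insert x A \<in> D} \<and> card A = Suc i'"
      "\<forall>A. ?kd b1 A = c1 A"
      using link[OF Suc] unfolding acyclic_at_def by blast
    \<comment> \<open>The minus sign compensates the one in \<open>ksign_exchange\<close>, so that
      on sets containing \<open>x\<close> the boundary is \<open>c\<close> and not its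
      negative.\<close>
    define b' where "b' = (\<lambda>A. (if x \<in> A then - ksign x (A - {x}) (b1 (A - {x})) else 0))"
    show ?thesis
    proof (intro exI[of _ b'] conjI allI impI)
      fix A
      { assume "b' A \<noteq> 0"
        then have x: "x \<in> A" and "b1 (A - {x}) \<noteq> 0"
          by (auto simp: b'_def split: if_splits)
        then have "insert x (A - {x}) \<in> D" "card (A - {x}) = i" using b1(1) Suc by auto
        with x show "A \<in> D" "card A = Suc i"
          using card_Suc_Diff1[of A x] by (simp_all add: insert_absorb) }
      { assume "x \<in> A"
        then obtain B where B: "A = insert x B" "x \<notin> B" by (meson Set.set_insert)
        have "?kd b' A = (\<Sum>z\<in>-insert x B. ksign x B (ksign z B (b1 (insert z B))))"
          unfolding kd_def B(1)
        proof (intro sum.cong refl)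
          fix z assume "z \<in> - insert x B"
          then have z: "x \<noteq> z" "z \<notin> B" "insert z (insert x B) - {x} = insert z B" using B by auto
          have "b' (insert z (insert x B)) = - ksign x (insert z B) (b1 (insert z B))"
            unfolding b'_def z(3) by simp
          then show "ksign z (insert x B) (b' (insert z (insert x B))) = ksign x B (ksign z B (b1 (insert z B)))"
            unfolding ksign_minus ksign_exchange[OF z(1) B(2) z(2)] by (simp add: ksign_minus ksign_exchange[OF z(1) B(2) z(2)])
        qed
        \<comment> \<open>The new term \<open>z = x\<close> is zero, since \<open>b1\<close>
          vanishes on sets containing \<open>x\<close>.\<close>
        also have "\<dots> = (\<Sum>z\<in>insert x (-insert x B). ksign x B (ksign z B (b1 (insert z B))))"
          using b1(1) by auto
        also have "insert x (- insert x B) = - B" using B by auto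
        also have "(\<Sum>z\<in>-B. ksign x B (ksign z B (b1 (insert z B)))) = ksign x B (c1 B)"
          using b1(2) by (simp flip: ksign_sum add: kd_def)
        finally show "?kd b' A = c A" using B by (simp add: c1_def) }
      note c_eq = this
      { assume nz: "?kd b' A \<noteq> 0"
        have "A \<in> D \<and> card A = i"
        proof (cases "x \<in> A")
          case True
          then show ?thesis using c_eq c(1) nz by auto
        next
          case False
          then have "b1 A \<noteq> 0"
            using kd_cone[of x b' A] nz by (auto simp: b'_def)
          then show ?thesis using b1(1) down Suc by auto
        qed
        then show "A \<in> D" "card A = i" by auto }
    qed
  qed
  then obtain b' where b': "\<And>A. b' A \<noteq> 0 \<Longrightarrow> A \<in> D \<and> card A = Suc i" "\<And>A. x \<in> A \<Longrightarrow> ?kd b' A = c A"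
    "\<And>A. ?kd b' A \<noteq> 0 \<Longrightarrow> A \<in> D \<and> card A = i" by blast
  define c' where "c' = (\<lambda>A. c A - ?kd b' A)"
  have "\<forall>A. ?kd c' A = 0"
    unfolding c'_def triv_kd_diff triv_kd_kd using c(2) by simp
  moreover have "\<forall>A. c' A \<noteq> 0 \<longrightarrow> A \<in> {A \<in> D. x \<notin> A} \<and> card A = i"
  proof (intro allI impI)
    fix A assume nz: "c' A \<noteq> 0"
    then have "x \<notin> A" using b'(2)[of A] by (auto simp: c'_def)
    moreover have "c A \<noteq> 0 \<or> ?kd b' A \<noteq> 0" using nz by (auto simp: c'_def)
    ultimately show "A \<in> {A \<in> D. x \<notin> A} \<and> card A = i" using c(1) b'(3)[of A] by auto
  qed
  ultimately obtain b where b: "\<forall>A. b A \<noteq> 0 \<longrightarrow> A \<in> {A \<in> D. x \<notin> A} \<and> card A = Suc i" "\<forall>A. ?kd b A = c' A"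
    using del unfolding acyclic_at_def by blast
  show "\<exists>b. (\<forall>A. b A \<noteq> 0 \<longrightarrow> A \<in> D \<and> card A = Suc i) \<and> (\<forall>A. ?kd b A = c A)"
  proof (intro exI[of _ "\<lambda>A. b A + b' A"] conjI allI impI)
    fix A
    show "?kd (\<lambda>A. b A + b' A) A = c A"
      unfolding triv_kd_add using b(2) by (simp add: c'_def)
    assume "b A + b' A \<noteq> 0"
    then have "b A \<noteq> 0 \<or> b' A \<noteq> 0" by auto
    then show "A \<in> D" "card A = Suc i" using b(1) b'(1) by blast+
  qed
qed

section \<open>The transversal matroid\<close>

text \<open>Independence of \<open>D\<close> in the transversal matroid presented by the
  neighbourhoods of the vertices in \<open>W\<close>, with \<open>f\<close> as witness.\<close>

definition matching_map :: "'v set set \<Rightarrow> 'v set \<Rightarrow> 'v set \<Rightarrow> ('v \<Rightarrow> 'v) \<Rightarrow> bool" where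
  "matching_map E W D f \<longleftrightarrow> inj_on f D \<and> f ` D \<subseteq> W \<and> (\<forall>y\<in>D. {y, f y} \<in> E)"

lemma matching_map_fun_upd:
  assumes "matching_map E (W - {u}) D f" "u \<in> W" "y \<notin> D" "{y, u} \<in> E"
  shows "matching_map E W (insert y D) (f(y := u))"
proof -
  have "inj_on (f(y := u)) (insert y D)"
    using assms unfolding matching_map_def by (auto simp: inj_on_def)
  moreover have "(f(y := u)) ` insert y D \<subseteq> W"
    using assms unfolding matching_map_def by auto
  moreover have "\<forall>z\<in>insert y D. {z, (f(y := u)) z} \<in> E"
    using assms unfolding matching_map_def by auto
  ultimately show ?thesis unfolding matching_map_def by blast
qed

lemma matching_map_remove:
  assumes "matching_map E W D f" "x \<in> D"
  shows "matching_map E (W - {f x}) (D - {x}) f"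
  using assms unfolding matching_map_def by (auto simp: inj_on_def)

text \<open>The induction follows the alternating path of the two matchings that starts at \<open>x\<close>.\<close>

lemma matching_map_exchange:
  fixes f g :: "'v::finite \<Rightarrow> 'v"
  assumes "matching_map E W C f" "matching_map E W D g" "x \<in> C" "x \<notin> D"
  shows "(\<exists>h. matching_map E W (insert x D) h) \<or>
    (\<exists>y h. y \<in> D \<and> y \<notin> C \<and> matching_map E W (insert y (C - {x})) h)"
  using assms
proof (induction "card D" arbitrary: C D W x rule: less_induct)
  case less
  let ?u = "f x"
  have u: "?u \<in> W" "{x, ?u} \<in> E" using less.prems unfolding matching_map_def by auto
  show ?case
  proof (cases "?u \<in> g ` D")
    case False
    with less.prems(2) have "matching_map E (W - {?u}) D g"
      unfolding matching_map_def by blast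
    then show ?thesis using matching_map_fun_upd[OF _ u(1) less.prems(4) u(2)] by blast
  next
    case True
    then obtain z where z: "z \<in> D" "g z = ?u" by auto
    then have edge: "{z, ?u} \<in> E" using less.prems unfolding matching_map_def by auto
    have f': "matching_map E (W - {?u}) (C - {x}) f"
      by (rule matching_map_remove[OF less.prems(1,3)])
    have g': "matching_map E (W - {?u}) (D - {z}) g"
      using matching_map_remove[OF less.prems(2) z(1)] z(2) by simp
    show ?thesis
    proof (cases "z \<in> C")
      case False
      then have "matching_map E W (insert z (C - {x})) (f(z := ?u))"
        using matching_map_fun_upd[OF f' u(1) _ edge] by auto
      then show ?thesis using z False by blast
    next
      case True
      \<comment> \<open>The recursion runs in \<open>W - {?u}\<close>. There \<open>z\<close> plays
        the role of \<open>x\<close>: it is still matched by \<open>f\<close>, but has lost its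
        partner under \<open>g\<close>.\<close>
      have zx: "z \<in> C - {x}" using True z less.prems by auto
      have "card (D - {z}) < card D" using card_Diff1_less[OF finite z(1)] .
      from less.hyps[OF this f' g' zx] consider
        h where "matching_map E (W - {?u}) (insert z (D - {z})) h"
        | y h where "y \<in> D - {z}" "y \<notin> C - {x}" "matching_map E (W - {?u}) (insert y (C - {x} - {z})) h"
        by auto
      then show ?thesis
      proof cases
        case (1 h)
        then have "matching_map E (W - {?u}) D h" using z by (simp add: insert_absorb)
        then show ?thesis using matching_map_fun_upd[OF _ u(1) less.prems(4) u(2)] by blast
      next
        case (2 y h)
        have y: "y \<in> D" "y \<notin> C" "y \<noteq> z" using 2 less.prems by auto
        have "matching_map E W (insert z (insert y (C - {x} - {z}))) (h(z := ?u))"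
          using y by (intro matching_map_fun_upd[OF 2(3) u(1) _ edge]) auto
        moreover have "insert z (insert y (C - {x} - {z})) = insert y (C - {x})"
          using zx by auto
        ultimately show ?thesis using y by auto
      qed
    qed
  qed
qed

text \<open>This says that \<open>Q\<close> has rank at least \<open>s\<close> in the transversal
  matroid of \<open>W\<close>.\<close>

definition matches :: "'v set set \<Rightarrow> 'v set \<Rightarrow> nat \<Rightarrow> 'v set \<Rightarrow> bool" where
  "matches E W s Q \<longleftrightarrow> (\<exists>D f. D \<subseteq> Q \<and> card D = s \<and> matching_map E W D f)"

lemma matches_mono:
  assumes "matches E W s Q" "W \<subseteq> W'" "Q \<subseteq> Q'"
  shows "matches E W' s Q'"
proof -
  obtain D f where D: "D \<subseteq> Q" "card D = s" "matching_map E W D f"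
    using assms(1) unfolding matches_def by auto
  have "matching_map E W' D f"
    using D(3) assms(2) unfolding matching_map_def by auto
  then show ?thesis
    unfolding matches_def using D(1,2) assms(3) by (intro exI[of _ D] exI[of _ f]) auto
qed

text \<open>\<open>P\<close> collects the elements already decided to stay outside the faces, and
  \<open>card D0\<close> bounds the rank of \<open>P\<close> from below. Deletion of
  \<open>x\<close> moves \<open>x\<close> from \<open>U\<close> to \<open>P\<close> and into
  \<open>D0\<close>; the link of \<open>x\<close> lowers both \<open>card U\<close> and
  \<open>i\<close>. Both preserve the inequality, and for empty \<open>U\<close> it contradicts
  \<open>card D0 \<le> s\<close>.\<close>

lemma acyclic_at_matroid:
  fixes U P :: "'v::finite set"
  assumes "U \<inter> P = {}" "D0 \<subseteq> P" "matching_map E W D0 g" "card D0 \<le> s" "i + s < card U + card D0"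
  shows "acyclic_at TYPE('k::field) {q. q \<subseteq> U \<and> matches E W s ((U - q) \<union> P)} i"
  using finite[of U] assms
proof (induction U arbitrary: P D0 g i rule: finite_induct)
  case empty
  then show ?case by simp
next
  case (insert x U)
  let ?D = "{q. q \<subseteq> insert x U \<and> matches E W s ((insert x U - q) \<union> P)}"
  have x: "x \<notin> U" "x \<notin> P" "x \<notin> D0" using insert by auto
  show ?case
  proof (cases "card D0 < s \<and> (\<exists>h. matching_map E W (insert x D0) h)")
    \<comment> \<open>Either \<open>D0\<close> alone has rank \<open>s\<close>, or \<open>x\<close>
      cannot be added to \<open>D0\<close>, so that any witness using \<open>x\<close> can exchange
      it for an element of \<open>D0\<close>. In both situations \<open>x\<close> can join every
      face.\<close>
    case False
    show ?thesis
    proof (rule acyclic_at_cone)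
      fix A assume A: "A \<in> ?D"
      have eq: "(insert x U - insert x A) \<union> P = ((insert x U - A) \<union> P) - {x}" using x by auto
      have "matches E W s (((insert x U - A) \<union> P) - {x})"
      proof (cases "card D0 < s")
        case False
        then have "card D0 = s" "D0 \<subseteq> ((insert x U - A) \<union> P) - {x}" using insert x by auto
        then show ?thesis unfolding matches_def using insert.prems(3) by blast
      next
        case True
        then have no: "\<not> (\<exists>h. matching_map E W (insert x D0) h)" using \<open>\<not> (_ \<and> _)\<close> by auto
        obtain D f where D: "D \<subseteq> (insert x U - A) \<union> P" "card D = s" "matching_map E W D f"
          using A unfolding matches_def by auto
        show ?thesis
        proof (cases "x \<in> D")
          case False
          then show ?thesis unfolding matches_def using D by blast
        next
          case True
          from matching_map_exchange[OF D(3) insert.prems(3) True x(3)] no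
          obtain y h where y: "y \<in> D0" "y \<notin> D" "matching_map E W (insert y (D - {x})) h" by auto
          have "card (insert y (D - {x})) = s"
            using y D True card_Suc_Diff1[of D x] by simp
          moreover have "insert y (D - {x}) \<subseteq> ((insert x U - A) \<union> P) - {x}"
            using y D insert.prems(2) x by auto
          ultimately show ?thesis unfolding matches_def using y(3) by blast
        qed
      qed
      then show "insert x A \<in> ?D" using A eq by auto
    qed
  next
    case True
    then obtain h where h: "matching_map E W (insert x D0) h" by auto
    show ?thesis
    proof (rule acyclic_at_deletion_link[where x = x])
      fix A assume "insert x A \<in> ?D"
      then show "A \<in> ?D"
        using matches_mono[of E W s "(insert x U - insert x A) \<union> P" W "(insert x U - A) \<union> P"] by auto
    next
      have "{A \<in> ?D. x \<notin> A} = {q. q \<subseteq> U \<and> matches E W s ((U - q) \<union> insert x P)}"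
      proof (rule Collect_cong[of "\<lambda>A. A \<in> ?D \<and> x \<notin> A"])
        fix A
        have "(insert x U - A) \<union> P = (U - A) \<union> insert x P" if "x \<notin> A" using that by auto
        then show "(A \<in> ?D \<and> x \<notin> A) = (A \<subseteq> U \<and> matches E W s ((U - A) \<union> insert x P))"
          using x by (cases "x \<in> A") auto
      qed
      moreover have "acyclic_at TYPE('k) {q. q \<subseteq> U \<and> matches E W s ((U - q) \<union> insert x P)} i"
        using insert.prems insert.hyps x True by (intro insert.IH[OF _ _ h]) auto
      ultimately show "acyclic_at TYPE('k) {A \<in> ?D. x \<notin> A} i" by simp
    next
      fix i' assume i': "i = Suc i'"
      have "{A. x \<notin> A \<and> insert x A \<in> ?D} = {q. q \<subseteq> U \<and> matches E W s ((U - q) \<union> P)}"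
      proof (rule Collect_cong)
        fix A
        have "(insert x U - insert x A) \<union> P = (U - A) \<union> P" using x by auto
        then show "(x \<notin> A \<and> insert x A \<in> ?D) = (A \<subseteq> U \<and> matches E W s ((U - A) \<union> P))"
          using x by auto
      qed
      moreover have "acyclic_at TYPE('k) {q. q \<subseteq> U \<and> matches E W s ((U - q) \<union> P)} i'"
        using insert.prems insert.hyps i' by (intro insert.IH[OF _ insert.prems(2,3)]) auto
      ultimately show "acyclic_at TYPE('k) {A. x \<notin> A \<and> insert x A \<in> ?D} i'" by simp
    qed
  qed
qed

text \<open>A vertex \<open>x\<close> of \<open>W\<close> that stays out of the face remains
  available as a partner for good (deletion, \<open>x\<close> goes to \<open>P\<close>); one that
  lies in the face is lost (link). Neither choice touches \<open>B\<close>, which is why the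
  inequality counts only \<open>B\<close>. With \<open>W\<close> empty the partners are fixed and
  the matroid case applies.\<close>

lemma acyclic_at_matches:
  fixes W P B :: "'v::finite set"
  assumes "B \<inter> W = {}" "i + s < card B"
  shows "acyclic_at TYPE('k::field) {q. q \<subseteq> W \<union> B \<and> matches E ((W - q) \<union> P) s (B - q)} i"
  using finite[of W] assms
proof (induction W arbitrary: P i rule: finite_induct)
  case empty
  have "matching_map E P {} id" unfolding matching_map_def by simp
  then have "acyclic_at TYPE('k) {q. q \<subseteq> B \<and> matches E P s ((B - q) \<union> {})} i"
    using empty by (intro acyclic_at_matroid[of B "{}" "{}" _ _ id]) auto
  then show ?case by simp
next
  case (insert x W)
  let ?D = "{q. q \<subseteq> insert x W \<union> B \<and> matches E ((insert x W - q) \<union> P) s (B - q)}"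
  have x: "x \<notin> W" "x \<notin> B" using insert by auto
  show ?case
  proof (rule acyclic_at_deletion_link[where x = x])
    fix A assume "insert x A \<in> ?D"
    then show "A \<in> ?D"
      using matches_mono[of E "(insert x W - insert x A) \<union> P" s "B - insert x A" "(insert x W - A) \<union> P" "B - A"]
      by auto
  next
    have "{A \<in> ?D. x \<notin> A} = {q. q \<subseteq> W \<union> B \<and> matches E ((W - q) \<union> insert x P) s (B - q)}"
    proof (rule Collect_cong[of "\<lambda>A. A \<in> ?D \<and> x \<notin> A"])
      fix A
      have "(insert x W - A) \<union> P = (W - A) \<union> insert x P" if "x \<notin> A" using that by auto
      then show "(A \<in> ?D \<and> x \<notin> A) = (A \<subseteq> W \<union> B \<and> matches E ((W - A) \<union> insert x P) s (B - A))"
        using x by (cases "x \<in> A") auto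
    qed
    moreover have "acyclic_at TYPE('k) {q. q \<subseteq> W \<union> B \<and> matches E ((W - q) \<union> insert x P) s (B - q)} i"
      using insert.prems by (intro insert.IH) auto
    ultimately show "acyclic_at TYPE('k) {A \<in> ?D. x \<notin> A} i" by simp
  next
    fix i' assume i': "i = Suc i'"
    have "{A. x \<notin> A \<and> insert x A \<in> ?D} = {q. q \<subseteq> W \<union> B \<and> matches E ((W - q) \<union> P) s (B - q)}"
    proof (rule Collect_cong)
      fix A
      have "(insert x W - insert x A) \<union> P = (W - A) \<union> P" "B - insert x A = B - A" using x by auto
      then show "(x \<notin> A \<and> insert x A \<in> ?D) = (A \<subseteq> W \<union> B \<and> matches E ((W - A) \<union> P) s (B - A))"
        using x by auto
    qed
    moreover have "acyclic_at TYPE('k) {q. q \<subseteq> W \<union> B \<and> matches E ((W - q) \<union> P) s (B - q)} i'"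
      using insert.prems i' by (intro insert.IH) auto
    ultimately show "acyclic_at TYPE('k) {A. x \<notin> A \<and> insert x A \<in> ?D} i'" by simp
  qed
qed

text \<open>Each edge has one endpoint on either side, so a matching is recorded by its endpoints in
  \<open>Y\<close> together with the injection to their partners in \<open>X\<close>.\<close>

lemma matching_iff_matches:
  assumes bip: "bipartition E X Y"
  shows "(\<exists>M. matching E M \<and> card M = s \<and> \<Union>M \<subseteq> T) \<longleftrightarrow> matches E (T \<inter> X) s (T \<inter> Y)"
proof
  assume "\<exists>M. matching E M \<and> card M = s \<and> \<Union>M \<subseteq> T"
  then obtain M where M: "M \<subseteq> E" "pairwise disjnt M" "card M = s" "\<Union>M \<subseteq> T"
    unfolding matching_def by auto
  have "\<forall>e. \<exists>x y. e \<in> M \<longrightarrow> x \<in> X \<and> y \<in> Y \<and> e = {x, y}"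
    using bip subsetD[OF M(1)] unfolding bipartition_def by meson
  then obtain a b where ab: "\<And>e. e \<in> M \<Longrightarrow> a e \<in> X" "\<And>e. e \<in> M \<Longrightarrow> b e \<in> Y" "\<And>e. e \<in> M \<Longrightarrow> e = {a e, b e}"
    by metis
  have same: "e = e'" if "e \<in> M" "e' \<in> M" "z \<in> e" "z \<in> e'" for e e' z
    using M(2) that unfolding pairwise_def disjnt_def by blast
  have mem: "a e \<in> e" "b e \<in> e" if "e \<in> M" for e using ab(3)[OF that] by blast+
  have inja: "inj_on a M"
  proof (rule inj_onI)
    fix e e' assume "e \<in> M" "e' \<in> M" "a e = a e'"
    then show "e = e'" using same[of e e' "a e"] mem(1)[of e] mem(1)[of e'] by simp
  qed
  have injb: "inj_on b M"
  proof (rule inj_onI)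
    fix e e' assume "e \<in> M" "e' \<in> M" "b e = b e'"
    then show "e = e'" using same[of e e' "b e"] mem(2)[of e] mem(2)[of e'] by simp
  qed
  define f where "f = a \<circ> inv_into M b"
  have fb: "f (b e) = a e" if "e \<in> M" for e using that injb by (simp add: f_def)
  have "matching_map E (T \<inter> X) (b ` M) f"
    unfolding matching_map_def
  proof (intro conjI)
    show "inj_on f (b ` M)"
      by (rule inj_on_imageI) (use fb inja in \<open>simp cong: inj_on_cong\<close>)
    show "f ` b ` M \<subseteq> T \<inter> X"
    proof (rule image_subsetI)
      fix y assume "y \<in> b ` M"
      then obtain e where e: "e \<in> M" "y = b e" by auto
      then show "f y \<in> T \<inter> X" using fb[OF e(1)] ab(1)[OF e(1)] mem(1)[OF e(1)] M(4) by auto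
    qed
    show "\<forall>y\<in>b ` M. {y, f y} \<in> E"
    proof
      fix y assume "y \<in> b ` M"
      then obtain e where e: "e \<in> M" "y = b e" by auto
      have "{y, f y} = e" unfolding e(2) fb[OF e(1)] using ab(3)[OF e(1)] by blast
      then show "{y, f y} \<in> E" using e M(1) by auto
    qed
  qed
  moreover have "b ` M \<subseteq> T \<inter> Y" using ab(2) mem(2) M(4) by blast
  moreover have "card (b ` M) = s" using card_image[OF injb] M(3) by simp
  ultimately show "matches E (T \<inter> X) s (T \<inter> Y)" unfolding matches_def by blast
next
  assume "matches E (T \<inter> X) s (T \<inter> Y)"
  then obtain D f where D: "D \<subseteq> T \<inter> Y" "card D = s" "inj_on f D" "f ` D \<subseteq> T \<inter> X" "\<forall>y\<in>D. {y, f y} \<in> E"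
    unfolding matches_def matching_map_def by blast
  define m where "m = (\<lambda>y. {y, f y})"
  have XY: "X \<inter> Y = {}" using bip unfolding bipartition_def by blast
  have sep: "y \<noteq> f z" if "y \<in> D" "z \<in> D" for y z using that D XY by blast
  have disj: "m y \<inter> m z = {}" if "y \<in> D" "z \<in> D" "y \<noteq> z" for y z
    using sep that D(3) unfolding m_def by (auto dest: inj_onD)
  have "inj_on m D" using disj unfolding m_def inj_on_def by blast
  then have "card (m ` D) = s" using card_image D(2) by blast
  moreover have "matching E (m ` D)"
    unfolding matching_def
  proof
    show "m ` D \<subseteq> E" using D(5) by (auto simp: m_def)
    show "pairwise disjnt (m ` D)"
      by (rule pairwise_imageI) (use disj in \<open>simp add: disjnt_def\<close>)
  qed
  moreover have "\<Union>(m ` D) \<subseteq> T" using D unfolding m_def by blast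
  ultimately show "\<exists>M. matching E M \<and> card M = s \<and> \<Union>M \<subseteq> T" by blast
qed

section \<open>Multidegrees\<close>

lemma poly_mapping_sum_single: "(\<Sum>m\<in>Poly_Mapping.keys f. Poly_Mapping.single m (Poly_Mapping.lookup f m)) = f"
proof (rule poly_mapping_eqI)
  fix k
  show "Poly_Mapping.lookup (\<Sum>m\<in>Poly_Mapping.keys f. Poly_Mapping.single m (Poly_Mapping.lookup f m)) k = Poly_Mapping.lookup f k"
    by (simp add: lookup_sum lookup_single when_def in_keys_iff)
qed

lemma single_times_eq_sum:
  "Poly_Mapping.single a c * f = (\<Sum>m\<in>Poly_Mapping.keys f. Poly_Mapping.single (a + m) (c * Poly_Mapping.lookup f m))"
proof -
  have "Poly_Mapping.single a c * f
      = Poly_Mapping.single a c * (\<Sum>m\<in>Poly_Mapping.keys f. Poly_Mapping.single m (Poly_Mapping.lookup f m))"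
    by (simp only: poly_mapping_sum_single)
  also have "\<dots> = (\<Sum>m\<in>Poly_Mapping.keys f. Poly_Mapping.single (a + m) (c * Poly_Mapping.lookup f m))"
    by (simp only: sum_distrib_left mult_single)
  finally show ?thesis .
qed

lemma lookup_single_times_add:
  fixes a :: "'a::cancel_comm_monoid_add" and f :: "'a \<Rightarrow>\<^sub>0 'b::comm_ring_1"
  shows "Poly_Mapping.lookup (Poly_Mapping.single a c * f) (a + m) = c * Poly_Mapping.lookup f m"
  by (simp add: single_times_eq_sum lookup_sum lookup_single when_def in_keys_iff)

lemma lookup_single_times_not_add:
  fixes a :: "'a::cancel_comm_monoid_add" and f :: "'a \<Rightarrow>\<^sub>0 'b::comm_ring_1"
  assumes "\<And>m. k \<noteq> a + m"
  shows "Poly_Mapping.lookup (Poly_Mapping.single a c * f) k = 0"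
  using assms[symmetric] by (simp add: single_times_eq_sum lookup_sum lookup_single when_def)

lemma mon_degree_add: "mon_degree (a + b) = mon_degree a + mon_degree b"
  by (simp add: mon_degree_def lookup_add sum.distrib)

lemma mon_degree_eq_0 [simp]: "mon_degree a = 0 \<longleftrightarrow> a = 0"
proof
  assume "mon_degree a = 0"
  then have "\<forall>x. Poly_Mapping.lookup a x = 0" by (simp add: mon_degree_def)
  then show "a = 0" by (intro poly_mapping_eqI) simp
qed (simp add: mon_degree_def)

lemma mon_degree_single [simp]: "mon_degree (Poly_Mapping.single x n) = n"
  by (simp add: mon_degree_def lookup_single when_def)

lemma finite_mon_degree: "finite {m :: 'v::finite \<Rightarrow>\<^sub>0 nat. mon_degree m = d}"
proof (rule finite_imageD)
  have "finite {f :: 'v \<Rightarrow> nat. \<forall>x. (x \<in> UNIV \<longrightarrow> f x \<in> {..d}) \<and> (x \<notin> UNIV \<longrightarrow> f x = 0)}"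
    by (rule finite_set_of_finite_funs) simp_all
  moreover have "Poly_Mapping.lookup ` {m :: 'v \<Rightarrow>\<^sub>0 nat. mon_degree m = d}
    \<subseteq> {f. \<forall>x. (x \<in> UNIV \<longrightarrow> f x \<in> {..d}) \<and> (x \<notin> UNIV \<longrightarrow> f x = 0)}"
    by (auto simp: mon_degree_def intro!: member_le_sum)
  ultimately show "finite (Poly_Mapping.lookup ` {m :: 'v \<Rightarrow>\<^sub>0 nat. mon_degree m = d})"
    by (rule finite_subset[rotated])
  show "inj_on Poly_Mapping.lookup {m :: 'v \<Rightarrow>\<^sub>0 nat. mon_degree m = d}"
    by (rule inj_onI) (simp only: poly_mapping_eq_iff)
qed

lemma finite_mon_degree_int: "finite {m :: 'v::finite \<Rightarrow>\<^sub>0 nat. int (mon_degree m) = d}"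
  by (rule finite_subset[OF _ finite_mon_degree[of "nat d"]]) auto

section \<open>Homogeneous components of polynomials\<close>

lemma homogeneous_zero [simp]: "homogeneous d 0"
  by (simp add: homogeneous_def)

lemma homogeneous_add: "homogeneous d f \<Longrightarrow> homogeneous d g \<Longrightarrow> homogeneous d (f + g)"
  unfolding homogeneous_def using keys_add[of f g] by blast

lemma homogeneous_uminus: "homogeneous d f \<Longrightarrow> homogeneous d (- f)"
  unfolding homogeneous_def by (simp add: in_keys_iff)

lemma homogeneous_diff: "homogeneous d f \<Longrightarrow> homogeneous d g \<Longrightarrow> homogeneous d (f - g)"
  using homogeneous_add[of d f "- g"] homogeneous_uminus[of d g] by simp

lemma homogeneous_mult:
  assumes "homogeneous d f" "homogeneous e g"
  shows "homogeneous (d + e) (f * g)"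
  unfolding homogeneous_def
proof
  fix m assume "m \<in> Poly_Mapping.keys (f * g)"
  then obtain a b where "m = a + b" "a \<in> Poly_Mapping.keys f" "b \<in> Poly_Mapping.keys g"
    using keys_mult[of f g] by blast
  then show "int (mon_degree m) = d + e"
    using assms by (simp add: homogeneous_def mon_degree_add)
qed

lemma homogeneous_single: "int (mon_degree m) = d \<Longrightarrow> homogeneous d (Poly_Mapping.single m c)"
  by (simp add: homogeneous_def)

lemma homogeneous_Var: "homogeneous 1 (Var z)"
  unfolding Var_def by (rule homogeneous_single) simp

definition hcomp :: "int \<Rightarrow> ('v::finite, 'k::field) mpoly \<Rightarrow> ('v, 'k) mpoly" where
  "hcomp d f = (\<Sum>m\<in>{m. int (mon_degree m) = d}. Poly_Mapping.single m (Poly_Mapping.lookup f m))"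

lemma lookup_hcomp:
  "Poly_Mapping.lookup (hcomp d f) m = (if int (mon_degree m) = d then Poly_Mapping.lookup f m else 0)"
  by (simp add: hcomp_def lookup_sum lookup_single when_def finite_mon_degree_int)

lemma homogeneous_hcomp: "homogeneous d (hcomp d f)"
  by (auto simp: homogeneous_def in_keys_iff lookup_hcomp split: if_splits)

lemma hcomp_homogeneous: "homogeneous d f \<Longrightarrow> hcomp e f = (if d = e then f else 0)"
  by (intro poly_mapping_eqI) (auto simp: homogeneous_def lookup_hcomp in_keys_iff)

lemma hcomp_add: "hcomp d (f + g) = hcomp d f + hcomp d g"
  by (intro poly_mapping_eqI) (simp add: lookup_hcomp lookup_add)

lemma hcomp_zero [simp]: "hcomp d 0 = 0"
  by (intro poly_mapping_eqI) (simp add: lookup_hcomp)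

lemma hcomp_sum: "hcomp d (sum f S) = (\<Sum>x\<in>S. hcomp d (f x))"
  by (induction S rule: infinite_finite_induct) (auto simp: hcomp_add)

lemma sum_hcomp:
  assumes "finite S" "(\<lambda>m. int (mon_degree m)) ` Poly_Mapping.keys f \<subseteq> S"
  shows "(\<Sum>d\<in>S. hcomp d f) = f"
proof (rule poly_mapping_eqI)
  fix m
  have "int (mon_degree m) \<in> S \<or> Poly_Mapping.lookup f m = 0"
    using assms(2) by (auto simp: in_keys_iff)
  then show "Poly_Mapping.lookup (\<Sum>d\<in>S. hcomp d f) m = Poly_Mapping.lookup f m"
    using assms(1) by (auto simp: lookup_sum lookup_hcomp)
qed

lemma hcomp_times_homogeneous:
  assumes "homogeneous e g"
  shows "hcomp d (f * g) = hcomp (d - e) f * g"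
proof -
  have single: "hcomp d (Poly_Mapping.single m c * g) = hcomp (d - e) (Poly_Mapping.single m c) * g" for m c
  proof -
    have "homogeneous (int (mon_degree m) + e) (Poly_Mapping.single m c * g)"
      using assms by (intro homogeneous_mult homogeneous_single) simp
    moreover have "homogeneous (int (mon_degree m)) (Poly_Mapping.single m c)"
      by (rule homogeneous_single) simp
    ultimately show ?thesis by (auto simp: hcomp_homogeneous)
  qed
  have "hcomp d ((\<Sum>m\<in>Poly_Mapping.keys f. Poly_Mapping.single m (Poly_Mapping.lookup f m)) * g)
      = hcomp (d - e) (\<Sum>m\<in>Poly_Mapping.keys f. Poly_Mapping.single m (Poly_Mapping.lookup f m)) * g"
    unfolding sum_distrib_right hcomp_sum single ..
  then show ?thesis by (simp only: poly_mapping_sum_single)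
qed

section \<open>Multigraded strands of the Koszul complex\<close>

definition ind :: "'v::finite set \<Rightarrow> ('v \<Rightarrow>\<^sub>0 nat)" where
  "ind A = (\<Sum>x\<in>A. Poly_Mapping.single x 1)"

lemma lookup_ind: "Poly_Mapping.lookup (ind A) x = (if x \<in> A then 1 else 0)"
  by (simp add: ind_def lookup_sum lookup_single when_def)

lemma ind_insert: "z \<notin> A \<Longrightarrow> ind (insert z A) = Poly_Mapping.single z 1 + ind A"
  by (simp add: ind_def)

lemma mon_degree_ind: "mon_degree (ind A) = card A"
  by (simp add: mon_degree_def lookup_ind sum.If_cases)

lemma keys_ind: "Poly_Mapping.keys (ind A) = A"
  by (auto simp: in_keys_iff lookup_ind split: if_splits)

text \<open>The component in multidegree \<open>a\<close> of a chain of the Koszul complex of the polynomial ring.\<close>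

definition multi_comp :: "('v::finite set \<Rightarrow> ('v, 'k::field) mpoly) \<Rightarrow> ('v \<Rightarrow>\<^sub>0 nat) \<Rightarrow> 'v set \<Rightarrow> 'k" where
  "multi_comp c a A = (if \<exists>m. a = m + ind A then Poly_Mapping.lookup (c A) (a - ind A) else 0)"

lemma multi_comp_add_ind: "multi_comp c (m + ind A) A = Poly_Mapping.lookup (c A) m"
  unfolding multi_comp_def by auto

lemma multi_comp_eq_0: "(\<And>m. a \<noteq> m + ind A) \<Longrightarrow> multi_comp c a A = 0"
  unfolding multi_comp_def by auto

lemma lookup_ksign: "Poly_Mapping.lookup (ksign z A v) m = ksign z A (Poly_Mapping.lookup v m)"
  by (simp add: ksign_def)

lemma lookup_Var_times:
  assumes "z \<notin> A"
  shows "Poly_Mapping.lookup (Var z * c (insert z A)) m = multi_comp c (m + ind A) (insert z A)"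
proof (cases "\<exists>m'. m = Poly_Mapping.single z 1 + m'")
  case True
  then obtain m' where m: "m = Poly_Mapping.single z 1 + m'" by auto
  have "m + ind A = m' + ind (insert z A)"
    using assms by (simp add: m ind_insert ac_simps)
  then show ?thesis
    by (simp only: multi_comp_add_ind m Var_def lookup_single_times_add mult_1)
next
  case False
  have "m + ind A \<noteq> m' + ind (insert z A)" for m'
  proof
    assume "m + ind A = m' + ind (insert z A)"
    also have "\<dots> = (Poly_Mapping.single z 1 + m') + ind A"
      using assms by (simp add: ind_insert ac_simps)
    finally show False using False by (auto simp only: add_right_cancel)
  qed
  then show ?thesis
    using False by (simp add: multi_comp_eq_0 Var_def lookup_single_times_not_add)
qed

text \<open>In a fixed multidegree each coefficient has at most one monomial, and a variable carries
  it to the monomial belonging to the smaller set with coefficient 1. Hence a strand is a simplicial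
  chain complex with trivial action.\<close>

lemma kd_multi_comp:
  "kd (\<lambda>z v. v) (multi_comp c a) A = multi_comp (kd (\<lambda>z f. Var z * f) c) a A"
proof (cases "\<exists>m. a = m + ind A")
  case True
  then obtain m where a: "a = m + ind A" by auto
  have "kd (\<lambda>z v. v) (multi_comp c a) A = (\<Sum>z\<in>-A. Poly_Mapping.lookup (ksign z A (Var z * c (insert z A))) m)"
    unfolding kd_def a by (intro sum.cong refl) (simp add: lookup_ksign lookup_Var_times)
  then show ?thesis
    by (simp add: a multi_comp_add_ind kd_def lookup_sum)
next
  case False
  have "multi_comp c a (insert z A) = 0" if "z \<notin> A" for z
  proof (rule multi_comp_eq_0)
    show "a \<noteq> m + ind (insert z A)" for m
      using False by (simp add: ind_insert[OF that] flip: add.assoc)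
  qed
  then show ?thesis using False by (simp add: kd_def multi_comp_eq_0)
qed

text \<open>For a monomial ideal with exponent set \<open>U\<close>, the sets that occur in
  multidegree \<open>a\<close> form the upper Koszul simplicial complex of the ideal at
  \<open>a\<close>. A cycle is filled in each multidegree separately and the fillings are
  reassembled.\<close>

lemma exact_at_monomial:
  fixes U :: "('v::finite \<Rightarrow>\<^sub>0 nat) set"
  assumes acyc: "\<And>a. int (mon_degree a) = j \<Longrightarrow> acyclic_at TYPE('k::field) {A. \<exists>m\<in>U. a = m + ind A} i"
  shows "exact_at (\<lambda>z f. Var z * f) (\<lambda>j. {f :: ('v, 'k) mpoly. Poly_Mapping.keys f \<subseteq> U \<and> homogeneous j f}) i j"
  unfolding exact_at_def
proof (intro allI impI, elim conjE)
  let ?kd = "kd (\<lambda>z f :: ('v, 'k) mpoly. Var z * f)"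
  fix c :: "'v set \<Rightarrow> ('v, 'k) mpoly"
  assume c: "\<forall>A. c A \<in> {f. Poly_Mapping.keys f \<subseteq> U \<and> homogeneous (j - int (card A)) f}"
    "\<forall>A. card A \<noteq> i \<longrightarrow> c A = 0" "\<forall>A. ?kd c A = 0"
  let ?P = "\<lambda>a b. (\<forall>A. b A \<noteq> 0 \<longrightarrow> (\<exists>m\<in>U. a = m + ind A) \<and> card A = Suc i)
      \<and> (\<forall>A. kd (\<lambda>z v. v) b A = multi_comp c a A)"
  have "\<exists>b. int (mon_degree a) = j \<longrightarrow> ?P a b" for a
  proof (cases "int (mon_degree a) = j")
    case True
    have "A \<in> {A. \<exists>m\<in>U. a = m + ind A} \<and> card A = i" if nz: "multi_comp c a A \<noteq> 0" for A
    proof -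
      obtain m where m: "a = m + ind A" using nz multi_comp_eq_0[of a A c] by blast
      then have "Poly_Mapping.lookup (c A) m \<noteq> 0" using nz by (simp add: multi_comp_add_ind)
      then have "m \<in> U" "c A \<noteq> 0" using c(1) by (auto simp flip: in_keys_iff)
      then show ?thesis using m c(2) by auto
    qed
    moreover have "kd (\<lambda>z v. v) (multi_comp c a) A = 0" for A
      unfolding kd_multi_comp using c(3) by (simp add: multi_comp_def)
    ultimately obtain b where
      "\<forall>A. b A \<noteq> 0 \<longrightarrow> A \<in> {A. \<exists>m\<in>U. a = m + ind A} \<and> card A = Suc i"
      "\<forall>A. kd (\<lambda>z v. v) b A = multi_comp c a A"
      using acyc[OF True, unfolded acyclic_at_def, THEN spec, of "multi_comp c a"] by blast
    then show ?thesis by (intro exI[of _ b]) simp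
  qed simp
  then obtain B where B: "\<And>a. int (mon_degree a) = j \<Longrightarrow> ?P a (B a)" by metis
  \<comment> \<open>The monomial \<open>m\<close> at \<open>e_A\<close> has multidegree
    \<open>m + ind A\<close>, so its coefficient is taken from the filling for that multidegree.
    Fixing the total degree keeps the sum finite.\<close>
  define b where "b = (\<lambda>A. \<Sum>m\<in>{m. int (mon_degree m) = j - int (card A)}. Poly_Mapping.single m (B (m + ind A) A))"
  have lb: "Poly_Mapping.lookup (b A) m = (if int (mon_degree m) = j - int (card A) then B (m + ind A) A else 0)" for A m
    by (simp add: b_def lookup_sum lookup_single when_def finite_mon_degree_int)
  have deg: "int (mon_degree (m + ind A)) = j \<longleftrightarrow> int (mon_degree m) = j - int (card A)" for m and A :: "'v set"
    by (auto simp: mon_degree_add mon_degree_ind)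
  show "\<exists>b. (\<forall>A. b A \<in> {f. Poly_Mapping.keys f \<subseteq> U \<and> homogeneous (j - int (card A)) f}) \<and>
      (\<forall>A. card A \<noteq> Suc i \<longrightarrow> b A = 0) \<and> (\<forall>A. ?kd b A = c A)"
  proof (intro exI[of _ b] conjI allI impI)
    fix A :: "'v set"
    have "m \<in> U \<and> card A = Suc i" if "Poly_Mapping.lookup (b A) m \<noteq> 0" for m
    proof -
      have "int (mon_degree (m + ind A)) = j" "B (m + ind A) A \<noteq> 0"
        using that unfolding deg lb by (auto split: if_splits)
      from B[OF this(1)] this(2) obtain m' where "m' \<in> U" "m + ind A = m' + ind A" "card A = Suc i" by blast
      then show ?thesis by simp
    qed
    note supp = this
    have "homogeneous (j - int (card A)) (b A)"
      by (auto simp: homogeneous_def in_keys_iff lb split: if_splits)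
    then show "b A \<in> {f. Poly_Mapping.keys f \<subseteq> U \<and> homogeneous (j - int (card A)) f}"
      using supp by (auto simp: in_keys_iff)
    show "b A = 0" if "card A \<noteq> Suc i"
      using supp that by (intro poly_mapping_eqI) auto
    show "?kd b A = c A"
    proof (rule poly_mapping_eqI)
      fix m
      let ?a = "m + ind A"
      have eq: "Poly_Mapping.lookup (?kd b A) m = kd (\<lambda>z v. v) (multi_comp b ?a) A"
        by (simp only: kd_multi_comp multi_comp_add_ind)
      show "Poly_Mapping.lookup (?kd b A) m = Poly_Mapping.lookup (c A) m"
      proof (cases "int (mon_degree ?a) = j")
        case True
        have "multi_comp b ?a A' = B ?a A'" for A'
        proof (cases "\<exists>m'. ?a = m' + ind A'")
          case True': True
          then obtain m' where m': "?a = m' + ind A'" by auto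
          then have "int (mon_degree m') = j - int (card A')" using True deg[of m' A'] by simp
          then show ?thesis unfolding m' multi_comp_add_ind lb by simp
        next
          case False
          then have "B ?a A' = 0" using B[OF True] by blast
          then show ?thesis using False by (simp add: multi_comp_eq_0)
        qed
        then have "multi_comp b ?a = B ?a" by (rule ext)
        then show ?thesis using B[OF True] eq by (simp add: multi_comp_add_ind)
      next
        case False
        have "multi_comp b ?a A' = 0" for A'
        proof (cases "\<exists>m'. ?a = m' + ind A'")
          case True
          then obtain m' where m': "?a = m' + ind A'" by auto
          then have "int (mon_degree m') \<noteq> j - int (card A')" using False deg[of m' A'] by simp
          then show ?thesis unfolding m' multi_comp_add_ind lb by simp
        qed (simp add: multi_comp_eq_0)
        then have "kd (\<lambda>z v. v) (multi_comp b ?a) A = 0" by (simp add: kd_def)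
        moreover have "Poly_Mapping.lookup (c A) m = 0"
        proof -
          have "homogeneous (j - int (card A)) (c A)" using c(1) by blast
          then have "m \<notin> Poly_Mapping.keys (c A)" using False unfolding deg homogeneous_def by blast
          then show ?thesis by (simp add: in_keys_iff)
        qed
        ultimately show ?thesis using eq by simp
      qed
    qed
  qed
qed

lemma split_single:
  fixes m :: "'v \<Rightarrow>\<^sub>0 nat"
  assumes "Poly_Mapping.lookup m x \<ge> 1"
  shows "m = (m - Poly_Mapping.single x 1) + Poly_Mapping.single x 1"
  using assms by (intro poly_mapping_eqI) (auto simp: lookup_add lookup_minus lookup_single when_def)

text \<open>In a multidegree \<open>a \<noteq> 0\<close> the complex is the full simplex on the
  support of \<open>a\<close>, a cone. In multidegree 0 only the empty face is left, with homology
  in position 0 and degree 0.\<close>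

lemma exact_at_polynomial_ring:
  assumes "i \<ge> 1 \<or> j > 0"
  shows "exact_at (\<lambda>z f. Var z * f) (\<lambda>j. {f :: ('v::finite, 'k::field) mpoly. homogeneous j f}) i j"
proof -
  have "acyclic_at TYPE('k) {A. \<exists>m\<in>UNIV. a = m + ind A} i" if deg: "int (mon_degree a) = j" for a :: "'v \<Rightarrow>\<^sub>0 nat"
  proof (cases "a = 0")
    case True
    then have "mon_degree a = 0" by simp
    then have i: "i \<ge> 1" using assms deg by linarith
    have card0: "card A = 0" if "a = m + ind A" for m A
    proof -
      have "mon_degree (m + ind A) = 0" using that True by simp
      then show ?thesis by (simp add: mon_degree_add mon_degree_ind)
    qed
    then have no: "\<not> (A \<in> {A. \<exists>m\<in>UNIV. a = m + ind A} \<and> card A = i)" for A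
      using i card0 by force
    show ?thesis
      unfolding acyclic_at_def
    proof (intro allI impI, elim conjE)
      fix c :: "'v set \<Rightarrow> 'k"
      assume "\<forall>A. c A \<noteq> 0 \<longrightarrow> A \<in> {A. \<exists>m\<in>UNIV. a = m + ind A} \<and> card A = i"
      then have "c A = 0" for A using no by blast
      then show "\<exists>b. (\<forall>A. b A \<noteq> 0 \<longrightarrow> A \<in> {A. \<exists>m\<in>UNIV. a = m + ind A} \<and> card A = Suc i) \<and>
          (\<forall>A. kd (\<lambda>z v. v) b A = c A)"
        by (intro exI[of _ "\<lambda>A. 0"]) (simp add: kd_def)
    qed
  next
    case False
    then obtain x where x: "Poly_Mapping.lookup a x \<noteq> 0" by (metis lookup_zero poly_mapping_eqI)
    show ?thesis
    proof (rule acyclic_at_cone[where x = x])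
      fix A assume "A \<in> {A. \<exists>m\<in>UNIV. a = m + ind A}"
      then obtain m where m: "a = m + ind A" by auto
      show "insert x A \<in> {A. \<exists>m\<in>UNIV. a = m + ind A}"
      proof (cases "x \<in> A")
        case True
        then show ?thesis using m by (auto simp: insert_absorb)
      next
        case False
        then have "Poly_Mapping.lookup m x \<ge> 1" using x m by (simp add: lookup_add lookup_ind)
        from split_single[OF this] have "a = (m - Poly_Mapping.single x 1) + ind (insert x A)"
          unfolding ind_insert[OF False] add.assoc[symmetric] m by (rule arg_cong2[where f = "(+)", OF _ refl])
        then show ?thesis by blast
      qed
    qed
  qed
  from exact_at_monomial[OF this] show ?thesis by simp
qed

text \<open>A squarefree multidegree involves at most \<open>card X\<close> vertices of
  \<open>X\<close>, so more than \<open>i + s\<close> of its vertices must lie in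
  \<open>Y\<close>.\<close>

lemma acyclic_at_matching_monomials:
  fixes X Y :: "'v::finite set"
  assumes XY: "X \<union> Y = UNIV" "X \<inter> Y = {}" and deg: "i + card X + s < mon_degree a"
  shows "acyclic_at TYPE('k::field)
    {A. \<exists>m\<in>{m. matches E (Poly_Mapping.keys m \<inter> X) s (Poly_Mapping.keys m \<inter> Y)}. a = m + ind A} i"
    (is "acyclic_at _ ?D i")
proof (cases "\<exists>x. Poly_Mapping.lookup a x \<ge> 2")
  case True
  \<comment> \<open>Membership depends only on the support of \<open>m\<close>. As \<open>x\<close>
    occurs at least twice, one factor \<open>x\<close> can pass from \<open>m\<close> to the face
    without changing the support, so the complex is a cone.\<close>
  then obtain x where x: "Poly_Mapping.lookup a x \<ge> 2" by auto
  show ?thesis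
  proof (rule acyclic_at_cone[where x = x])
    fix A assume "A \<in> ?D"
    then obtain m where m: "a = m + ind A" "matches E (Poly_Mapping.keys m \<inter> X) s (Poly_Mapping.keys m \<inter> Y)" by auto
    show "insert x A \<in> ?D"
    proof (cases "x \<in> A")
      case True
      then show ?thesis using m by (auto simp: insert_absorb)
    next
      case False
      let ?m = "m - Poly_Mapping.single x 1"
      have mx: "Poly_Mapping.lookup m x \<ge> 2" using False x m(1) by (simp add: lookup_add lookup_ind)
      then have "Poly_Mapping.keys ?m = Poly_Mapping.keys m"
        by (auto simp: in_keys_iff lookup_minus lookup_single when_def)
      moreover have "a = ?m + ind (insert x A)"
        unfolding ind_insert[OF False] add.assoc[symmetric] m(1)
        by (rule arg_cong2[where f = "(+)", OF split_single refl]) (use mx in simp)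
      ultimately show ?thesis using m(2) by auto
    qed
  qed
next
  case False
  \<comment> \<open>For \<open>a = ind T\<close> the cofactor of \<open>ind A\<close> is
    \<open>ind (T - A)\<close>. This gives the complex of \<open>acyclic_at_matches\<close> with no
    partners held in reserve, that is, with \<open>P = {}\<close>.\<close>
  define T where "T = Poly_Mapping.keys a"
  have sq: "Poly_Mapping.lookup a x = (if x \<in> T then 1 else 0)" for x
    using False unfolding T_def in_keys_iff by (auto simp: not_le less_2_cases_iff dest: spec[of _ x])
  have aT: "a = ind T" by (rule poly_mapping_eqI) (simp add: sq lookup_ind)
  let ?W = "T \<inter> X" and ?B = "T \<inter> Y"
  have T: "?W \<union> ?B = T" "?W \<inter> ?B = {}" using XY by auto
  have "card ?W + card ?B = card T"
    using card_Un_disjoint[of ?W ?B] T by simp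
  moreover have "mon_degree a = card T" by (simp add: aT mon_degree_ind)
  moreover have "card ?W \<le> card X" by (simp add: card_mono)
  ultimately have "i + s < card ?B" using deg by linarith
  then have "acyclic_at TYPE('k) {q. q \<subseteq> ?W \<union> ?B \<and> matches E ((?W - q) \<union> {}) s (?B - q)} i"
    using T by (intro acyclic_at_matches) auto
  also have "{q. q \<subseteq> ?W \<union> ?B \<and> matches E ((?W - q) \<union> {}) s (?B - q)} = ?D"
  proof (rule Collect_cong)
    fix A
    have "a = m + ind A \<longleftrightarrow> A \<subseteq> T \<and> m = ind (T - A)" for m
    proof
      assume m: "a = m + ind A"
      have l: "Poly_Mapping.lookup a x = Poly_Mapping.lookup m x + (if x \<in> A then 1 else 0)" for x
        by (simp add: m lookup_add lookup_ind)
      have "A \<subseteq> T"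
      proof
        fix x assume "x \<in> A"
        then show "x \<in> T" using l[of x] sq[of x] by (auto split: if_splits)
      qed
      moreover have "m = ind (T - A)"
      proof (rule poly_mapping_eqI)
        fix x show "Poly_Mapping.lookup m x = Poly_Mapping.lookup (ind (T - A)) x"
          using l[of x] sq[of x] by (auto simp: lookup_ind split: if_splits)
      qed
      ultimately show "A \<subseteq> T \<and> m = ind (T - A)" ..
    next
      assume "A \<subseteq> T \<and> m = ind (T - A)"
      then show "a = m + ind A"
        by (intro poly_mapping_eqI) (auto simp: sq lookup_add lookup_ind)
    qed
    moreover have "(T - A) \<inter> X = (?W - A) \<union> {}" "(T - A) \<inter> Y = ?B - A" by auto
    ultimately show "(A \<subseteq> ?W \<union> ?B \<and> matches E ((?W - A) \<union> {}) s (?B - A)) =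
      (\<exists>m\<in>{m. matches E (Poly_Mapping.keys m \<inter> X) s (Poly_Mapping.keys m \<inter> Y)}. a = m + ind A)"
      unfolding T(1) by (auto simp: keys_ind)
  qed
  finally show ?thesis .
qed

section \<open>Syzygies and the Tor bound\<close>

text \<open>Elements of free modules are functions that vanish beyond the rank, since the vectors of
  \<open>free_mod\<close> do not form an additive group type.\<close>

type_synonym ('v, 'k) fvec = "nat \<Rightarrow> ('v, 'k) mpoly"

lemma sum_apply: "sum f S x = (\<Sum>s\<in>S. f s x)"
  by (induction S rule: infinite_finite_induct) auto

definition fsmul :: "('v::finite, 'k::field) mpoly \<Rightarrow> ('v, 'k) fvec \<Rightarrow> ('v, 'k) fvec" where
  "fsmul f v = (\<lambda>l. f * v l)"

lemma fsmul_apply [simp]: "fsmul f v l = f * v l"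
  by (simp add: fsmul_def)

lemma module_fsmul: "Modules.module fsmul"
  by standard (simp_all add: fun_eq_iff algebra_simps)

text \<open>Homogeneous pieces are not submodules over the polynomial ring, but they are vector
  spaces over the constants, and finite-dimensional ones.\<close>

definition kscale :: "'k::field \<Rightarrow> ('v::finite, 'k) fvec \<Rightarrow> ('v, 'k) fvec" where
  "kscale c = fsmul (Poly_Mapping.single 0 c)"

lemma vector_space_kscale: "vector_space kscale"
  by standard (simp_all add: kscale_def fun_eq_iff algebra_simps single_add mult_single
      mult.assoc[symmetric])

lemma commuting_action_fsmul: "commuting_action (\<lambda>z. fsmul (Var z))"
  by (simp add: commuting_action_def fun_eq_iff algebra_simps)

definition free :: "int list \<Rightarrow> ('v::finite, 'k::field) fvec set" where
  "free es = {v. \<forall>l\<ge>length es. v l = 0}"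

definition hvec :: "int list \<Rightarrow> int \<Rightarrow> ('v::finite, 'k::field) fvec \<Rightarrow> bool" where
  "hvec es j v \<longleftrightarrow> v \<in> free es \<and> (\<forall>l<length es. homogeneous (j - es ! l) (v l))"

definition gcomp :: "int list \<Rightarrow> int \<Rightarrow> ('v::finite, 'k::field) fvec \<Rightarrow> ('v, 'k) fvec" where
  "gcomp es j v = (\<lambda>l. if l < length es then hcomp (j - es ! l) (v l) else 0)"

definition graded_submodule :: "int list \<Rightarrow> ('v::finite, 'k::field) fvec set \<Rightarrow> bool" where
  "graded_submodule es N \<longleftrightarrow> N \<subseteq> free es \<and> Modules.module.subspace fsmul N \<and> (\<forall>j. \<forall>v\<in>N. gcomp es j v \<in> N)"

definition piece :: "int list \<Rightarrow> ('v::finite, 'k::field) fvec set \<Rightarrow> int \<Rightarrow> ('v, 'k) fvec set" where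
  "piece es N j = {v \<in> N. hvec es j v}"

definition comb :: "('v::finite, 'k::field) fvec list \<Rightarrow> ('v, 'k) fvec \<Rightarrow> ('v, 'k) fvec" where
  "comb G v = (\<Sum>l<length G. fsmul (v l) (G ! l))"

definition syz :: "int list \<Rightarrow> ('v::finite, 'k::field) fvec list \<Rightarrow> ('v, 'k) fvec set" where
  "syz es G = {v \<in> free es. comb G v = 0}"

definition hgens :: "int list \<Rightarrow> ('v::finite, 'k::field) fvec set \<Rightarrow> int list \<Rightarrow> ('v, 'k) fvec list \<Rightarrow> bool" where
  "hgens es N es' G \<longleftrightarrow> length G = length es' \<and> (\<forall>l<length es'. G ! l \<in> piece es N (es' ! l)) \<and>
     comb G ` free es' = N"

text \<open>For homogeneous generators this is minimality, since a nonzero constant term would allow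
  a generator to be expressed by the others. In this form it matches the condition on the entries of
  the next differential.\<close>

definition min_syz :: "int list \<Rightarrow> ('v::finite, 'k::field) fvec list \<Rightarrow> bool" where
  "min_syz es G \<longleftrightarrow> (\<forall>v\<in>syz es G. \<forall>l. Poly_Mapping.lookup (v l) 0 = 0)"

definition tor_bound :: "int list \<Rightarrow> ('v::finite, 'k::field) fvec set \<Rightarrow> int \<Rightarrow> bool" where
  "tor_bound es N d \<longleftrightarrow> (\<forall>i j. int i + d < j \<longrightarrow> exact_at (\<lambda>z. fsmul (Var z)) (piece es N) i j)"

section \<open>Free modules, generators and their graded components\<close>

lemma subspace_iff:
  "Modules.module.subspace fsmul N \<longleftrightarrow> 0 \<in> N \<and> (\<forall>v\<in>N. \<forall>w\<in>N. v + w \<in> N) \<and> (\<forall>f. \<forall>v\<in>N. fsmul f v \<in> N)"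
  by (simp add: module.subspace_def[OF module_fsmul])

lemma subspace_free: "Modules.module.subspace fsmul (free es)"
  by (simp add: subspace_iff free_def)

lemma comb_apply: "comb G v k = (\<Sum>l<length G. v l * (G ! l) k)"
  by (simp add: comb_def sum_apply)

lemma comb_add: "comb G (v + w) = comb G v + comb G w"
  by (simp add: fun_eq_iff comb_apply distrib_right sum.distrib)

lemma comb_zero: "comb G 0 = 0"
  by (simp add: fun_eq_iff comb_apply)

lemma comb_fsmul: "comb G (fsmul f v) = fsmul f (comb G v)"
  by (simp add: fun_eq_iff comb_apply sum_distrib_left mult.assoc)

lemma comb_diff: "comb G (v - w) = comb G v - comb G w"
  by (simp add: fun_eq_iff comb_apply left_diff_distrib sum_subtractf)

lemma comb_sum: "comb G (sum f S) = (\<Sum>x\<in>S. comb G (f x))"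
  unfolding fun_eq_iff sum_apply comb_apply sum_distrib_right by (intro allI sum.swap)

lemma comb_unit:
  assumes "l < length G"
  shows "comb G (\<lambda>k. if k = l then 1 else 0) = G ! l"
  using assms by (simp add: fun_eq_iff comb_apply if_distrib[of "\<lambda>x. x * _"] cong: if_cong)

lemma unit_in_free: "l < length es \<Longrightarrow> (\<lambda>k. if k = l then 1 else 0) \<in> free es"
  by (simp add: free_def)

lemma gcomp_in_free: "gcomp es j v \<in> free es"
  by (simp add: gcomp_def free_def)

lemma hvec_gcomp: "hvec es j (gcomp es j v)"
  by (simp add: hvec_def gcomp_in_free) (simp add: gcomp_def homogeneous_hcomp)

lemma gcomp_hvec: "hvec es j v \<Longrightarrow> gcomp es j v = v"
  by (auto simp: hvec_def free_def gcomp_def fun_eq_iff hcomp_homogeneous)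

lemma gcomp_zero: "gcomp es j 0 = 0"
  by (simp add: gcomp_def fun_eq_iff)

lemma hvec_zero: "hvec es j 0"
  by (simp add: hvec_def free_def)

lemma hvec_diff: "hvec es j v \<Longrightarrow> hvec es j w \<Longrightarrow> hvec es j (v - w)"
  by (simp add: hvec_def free_def homogeneous_diff)

lemma hvec_Var: "hvec es (j - 1) v \<Longrightarrow> hvec es j (fsmul (Var z) v)"
  using homogeneous_mult[OF homogeneous_Var[of z]]
  by (fastforce simp: hvec_def free_def algebra_simps)

lemma gcomp_comb:
  assumes G: "length G = length es'" "\<And>l. l < length es' \<Longrightarrow> hvec es (es' ! l) (G ! l)"
  shows "gcomp es j (comb G v) = comb G (gcomp es' j v)"
proof
  fix k
  show "gcomp es j (comb G v) k = comb G (gcomp es' j v) k"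
  proof (cases "k < length es")
    case True
    have "gcomp es j (comb G v) k = (\<Sum>l<length es'. hcomp (j - es ! k) (v l * (G ! l) k))"
      using True by (simp add: gcomp_def comb_apply hcomp_sum G)
    also have "\<dots> = (\<Sum>l<length es'. gcomp es' j v l * (G ! l) k)"
    proof (intro sum.cong refl)
      fix l assume "l \<in> {..<length es'}"
      then have l: "l < length es'" by simp
      have "homogeneous (es' ! l - es ! k) ((G ! l) k)"
        using G(2)[OF l] True by (simp add: hvec_def)
      from hcomp_times_homogeneous[OF this, of "j - es ! k" "v l"]
      show "hcomp (j - es ! k) (v l * (G ! l) k) = gcomp es' j v l * (G ! l) k"
        using l by (simp add: gcomp_def)
    qed
    finally show ?thesis by (simp add: comb_apply G)
  next
    case False
    then have "(G ! l) k = 0" if "l < length es'" for l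
      using G(2)[OF that] by (simp add: hvec_def free_def)
    then show ?thesis using False by (simp add: gcomp_def comb_apply G)
  qed
qed

lemma hgensD:
  assumes "hgens es N es' G"
  shows "length G = length es'" "\<And>l. l < length es' \<Longrightarrow> hvec es (es' ! l) (G ! l)"
    "\<And>l. l < length es' \<Longrightarrow> G ! l \<in> N" "comb G ` free es' = N"
  using assms unfolding hgens_def piece_def by auto

lemma hgensI:
  assumes G: "length G = length es'" "\<And>l. l < length es' \<Longrightarrow> hvec es (es' ! l) (G ! l)"
    and N: "comb G ` free es' = N"
  shows "hgens es N es' G"
  unfolding hgens_def piece_def
proof (intro conjI allI impI)
  fix l assume l: "l < length es'"
  then have "G ! l = comb G (\<lambda>k. if k = l then 1 else 0)" using comb_unit G(1) by metis
  then have "G ! l \<in> N" using N unit_in_free[OF l] by blast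
  then show "G ! l \<in> {v \<in> N. hvec es (es' ! l) v}" using G(2)[OF l] by simp
qed (use G(1) N in auto)

lemma graded_submodule_syz:
  assumes "hgens es N es' G"
  shows "graded_submodule es' (syz es' G)"
  unfolding graded_submodule_def
proof (intro conjI allI ballI)
  show "syz es' G \<subseteq> free es'" by (auto simp: syz_def)
  show "Modules.module.subspace fsmul (syz es' G)"
    using subspace_free[of es'] unfolding subspace_iff syz_def
    by (auto simp: comb_zero comb_add comb_fsmul fun_eq_iff)
  fix j v assume "v \<in> syz es' G"
  then show "gcomp es' j v \<in> syz es' G"
    using gcomp_comb[OF hgensD(1,2)[OF assms], of j v] by (simp add: syz_def gcomp_in_free gcomp_zero)
qed

text \<open>A preimage of a homogeneous element may be replaced by its component of the same degree,
  so surjectivity holds degree by degree, as \<open>exact_at_kernel\<close> requires.\<close>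

lemma comb_piece:
  assumes "hgens es N es' G"
  shows "comb G ` {v. hvec es' j v} = piece es N j"
proof (intro equalityI subsetI)
  fix y assume "y \<in> comb G ` {v. hvec es' j v}"
  then obtain v where v: "hvec es' j v" "y = comb G v" by auto
  then have "y = gcomp es j y"
    using gcomp_comb[OF hgensD(1,2)[OF assms], of j v] gcomp_hvec[OF v(1)] by simp
  then have "hvec es j y" using hvec_gcomp by metis
  moreover have "y \<in> N" using v hgensD(4)[OF assms] by (auto simp: hvec_def)
  ultimately show "y \<in> piece es N j" by (simp add: piece_def)
next
  fix y assume y: "y \<in> piece es N j"
  then obtain v where "v \<in> free es'" "y = comb G v"
    using hgensD(4)[OF assms] by (auto simp: piece_def)
  then have "y = comb G (gcomp es' j v)"
    using gcomp_comb[OF hgensD(1,2)[OF assms], of j v] gcomp_hvec[of es j y] y by (simp add: piece_def)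
  then show "y \<in> comb G ` {v. hvec es' j v}" using hvec_gcomp by blast
qed

section \<open>Koszul homology of free modules and syzygies\<close>

lemma kd_fsmul_apply:
  fixes c :: "'v::finite set \<Rightarrow> ('v, 'k::field) fvec"
  shows "kd (\<lambda>z. fsmul (Var z)) c A l = kd (\<lambda>z f. Var z * f) (\<lambda>A. c A l) A"
proof -
  have "ksign z A v l = ksign z A (v l)" for z and A :: "'v set" and v :: "('v, 'k) fvec"
    by (simp add: ksign_def)
  then show ?thesis by (simp add: kd_def sum_apply)
qed

text \<open>Each component is a shifted polynomial ring, whose Koszul homology sits in position 0
  and in the degree of its generator.\<close>

lemma exact_at_free:
  assumes "i \<ge> 1 \<or> (\<forall>e\<in>set es. e < j)"
  shows "exact_at (\<lambda>z. fsmul (Var z :: ('v::finite, 'k::field) mpoly)) (\<lambda>j. {v. hvec es j v}) i j"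
  unfolding exact_at_def
proof (intro allI impI, elim conjE)
  let ?kd = "kd (\<lambda>z. fsmul (Var z :: ('v, 'k) mpoly))"
  let ?kd' = "kd (\<lambda>z f :: ('v, 'k) mpoly. Var z * f)"
  fix c :: "'v set \<Rightarrow> ('v, 'k) fvec"
  assume c: "\<forall>A. c A \<in> {v. hvec es (j - int (card A)) v}" "\<forall>A. card A \<noteq> i \<longrightarrow> c A = 0" "\<forall>A. ?kd c A = 0"
  have "\<exists>b. (\<forall>A. homogeneous (j - es ! l - int (card A)) (b A)) \<and> (\<forall>A. card A \<noteq> Suc i \<longrightarrow> b A = 0) \<and>
      (\<forall>A. ?kd' b A = c A l)" if l: "l < length es" for l
  proof -
    have "i \<ge> 1 \<or> j - es ! l > 0" using assms l by auto
    from exact_at_polynomial_ring[OF this, unfolded exact_at_def, THEN spec, of "\<lambda>A. c A l"]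
    moreover have "homogeneous (j - es ! l - int (card A)) (c A l)" for A
    proof -
      have "homogeneous (j - int (card A) - es ! l) (c A l)" using c(1) l unfolding hvec_def by blast
      moreover have "j - int (card A) - es ! l = j - es ! l - int (card A)" by simp
      ultimately show ?thesis by simp
    qed
    moreover have "c A l = 0" if "card A \<noteq> i" for A using c(2) that by simp
    moreover have "?kd' (\<lambda>A. c A l) A = 0" for A using c(3) by (simp flip: kd_fsmul_apply)
    ultimately show ?thesis unfolding mem_Collect_eq by blast
  qed
  then obtain B where B: "\<And>l A. l < length es \<Longrightarrow> homogeneous (j - es ! l - int (card A)) (B l A)"
    "\<And>l A. l < length es \<Longrightarrow> card A \<noteq> Suc i \<Longrightarrow> B l A = 0"
    "\<And>l A. l < length es \<Longrightarrow> ?kd' (B l) A = c A l" by metis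
  define b where "b = (\<lambda>A l. if l < length es then B l A else 0)"
  show "\<exists>b. (\<forall>A. b A \<in> {v. hvec es (j - int (card A)) v}) \<and> (\<forall>A. card A \<noteq> Suc i \<longrightarrow> b A = 0) \<and> (\<forall>A. ?kd b A = c A)"
  proof (intro exI[of _ b] conjI allI impI)
    fix A :: "'v set"
    show "b A \<in> {v. hvec es (j - int (card A)) v}"
      using B(1)[of _ A] by (simp add: hvec_def free_def b_def algebra_simps)
    show "b A = 0" if "card A \<noteq> Suc i"
      using B(2)[OF _ that] by (simp add: b_def fun_eq_iff)
    show "?kd b A = c A"
    proof
      fix l
      show "?kd b A l = c A l"
      proof (cases "l < length es")
        case True
        then show ?thesis unfolding kd_fsmul_apply using B(3)[OF True, of A] by (simp add: b_def)
      next
        case False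
        then have "c A l = 0" using c(1) by (simp add: hvec_def free_def)
        moreover have "?kd' (\<lambda>A. b A l) A = 0" using False by (simp add: kd_def b_def)
        ultimately show ?thesis unfolding kd_fsmul_apply by simp
      qed
    qed
  qed
qed

text \<open>Position \<open>i\<close> of the syzygies is controlled by position \<open>i + 1\<close>
  of \<open>N\<close>, which is where \<open>d + 1\<close> comes from. The free module interferes
  only in position 0, in degrees at most \<open>d\<close>.\<close>

lemma tor_bound_syz:
  fixes G :: "('v::finite, 'k::field) fvec list"
  assumes G: "hgens es N es' G" and d: "\<forall>e\<in>set es'. e \<le> d" and N: "tor_bound es N d"
  shows "tor_bound es' (syz es' G) (d + 1)"
  unfolding tor_bound_def
proof (intro allI impI)
  fix i j assume j: "int i + (d + 1) < j"
  have "exact_at (\<lambda>z. fsmul (Var z)) (\<lambda>j. {v \<in> {v. hvec es' j v}. comb G v = 0}) i j"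
  proof (rule exact_at_kernel[OF commuting_action_fsmul commuting_action_fsmul comb_add comb_fsmul comb_piece[OF G]])
    show "exact_at (\<lambda>z. fsmul (Var z :: ('v, 'k) mpoly)) (\<lambda>j. {v. hvec es' j v}) i j"
      using d j by (intro exact_at_free) auto
    show "exact_at (\<lambda>z. fsmul (Var z)) (piece es N) (Suc i) j"
      using N j unfolding tor_bound_def by auto
    show "0 \<in> {v. hvec es' j v}" for j using hvec_zero by blast
    show "v - w \<in> {v. hvec es' j v}" if "v \<in> {v. hvec es' j v}" "w \<in> {v. hvec es' j v}" for v w j
      using hvec_diff that by blast
    show "fsmul (Var z) v \<in> {v. hvec es' j v}" if "v \<in> {v. hvec es' (j - 1) v}" for z v j
      using hvec_Var that by blast
  qed
  moreover have "{v \<in> {v. hvec es' j v}. comb G v = 0} = piece es' (syz es' G) j" for j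
    by (auto simp: piece_def syz_def hvec_def)
  ultimately show "exact_at (\<lambda>z. fsmul (Var z)) (piece es' (syz es' G)) i j" by simp
qed

lemma lookup_times_0:
  fixes f g :: "('v::finite, 'k::field) mpoly"
  assumes "Poly_Mapping.lookup g 0 = 0"
  shows "Poly_Mapping.lookup (f * g) 0 = 0"
proof (rule ccontr)
  assume "Poly_Mapping.lookup (f * g) 0 \<noteq> 0"
  then have "0 \<in> Poly_Mapping.keys (f * g)" by (simp add: in_keys_iff)
  then obtain a b where ab: "0 = a + b" "b \<in> Poly_Mapping.keys g" using keys_mult[of f g] by blast
  have "mon_degree (a + b) = 0" unfolding ab(1)[symmetric] by simp
  then have "b = 0" by (simp add: mon_degree_add)
  then show False using ab(2) assms by (simp add: in_keys_iff)
qed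

lemma lookup_Var_0: "Poly_Mapping.lookup (Var z) 0 = 0"
proof -
  have "Poly_Mapping.single z (1::nat) \<noteq> 0" by (metis lookup_single_eq lookup_zero zero_neq_one)
  then show ?thesis by (simp add: Var_def lookup_single when_def)
qed

lemma lookup_Var_times_0:
  fixes f :: "('v::finite, 'k::field) mpoly"
  shows "Poly_Mapping.lookup (Var z * f) 0 = 0"
  using lookup_times_0[OF lookup_Var_0, of f z] by (simp only: mult.commute)

text \<open>Exactness in position 0, applied to the chain with value \<open>y\<close> at the empty
  set, which is trivially a cycle.\<close>

lemma piece_eq_sum_Var:
  fixes N :: "('v::finite, 'k::field) fvec set"
  assumes N: "graded_submodule es N" and ex: "exact_at (\<lambda>z. fsmul (Var z)) (piece es N) 0 j"
    and y: "y \<in> piece es N j"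
  shows "\<exists>b. (\<forall>z. b z \<in> piece es N (j - 1)) \<and> y = (\<Sum>z\<in>UNIV. fsmul (Var z) (b z))"
proof -
  let ?kd = "kd (\<lambda>z. fsmul (Var z :: ('v, 'k) mpoly))"
  define c where "c = (\<lambda>A :: 'v set. if A = {} then y else 0)"
  have "0 \<in> N" using N by (simp add: graded_submodule_def subspace_iff)
  then have "\<forall>A. c A \<in> piece es N (j - int (card A))"
    using y by (auto simp: c_def piece_def hvec_zero)
  moreover have "\<forall>A. card A \<noteq> 0 \<longrightarrow> c A = 0" by (simp add: c_def)
  moreover have "fsmul f 0 = 0" for f :: "('v, 'k) mpoly" by (simp add: fun_eq_iff)
  then have "\<forall>A. ?kd c A = 0" by (simp add: kd_def c_def)
  ultimately obtain b where b: "\<forall>A. b A \<in> piece es N (j - int (card A))" "\<forall>A. ?kd b A = c A"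
    using ex[unfolded exact_at_def, THEN spec, of c] by blast
  have "y = ?kd b {}" using b(2) by (simp add: c_def)
  also have "\<dots> = (\<Sum>z\<in>UNIV. fsmul (Var z) (b {z}))" by (simp add: kd_def ksign_def)
  finally have "y = (\<Sum>z\<in>UNIV. fsmul (Var z) (b {z}))" .
  moreover have "b {z} \<in> piece es N (j - 1)" for z using b(1)[THEN spec, of "{z}"] by simp
  ultimately show ?thesis by (intro exI[of _ "\<lambda>z. b {z}"]) simp
qed

text \<open>Graded Nakayama: a generator of degree above \<open>d\<close> is also a combination of
  the generators with coefficients in the ideal of the variables. The difference of the two
  expressions is a syzygy whose entry at \<open>l\<close> has constant term -1.\<close>

lemma min_gens_degree_le:
  fixes G :: "('v::finite, 'k::field) fvec list"
  assumes N: "graded_submodule es N" and tb: "tor_bound es N d"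
    and G: "hgens es N es' G" "min_syz es' G"
  shows "\<forall>e\<in>set es'. e \<le> d"
proof (rule ballI, rule ccontr)
  fix e assume "e \<in> set es'" "\<not> e \<le> d"
  then obtain l where l: "l < length es'" "es' ! l > d" by (auto simp: in_set_conv_nth)
  have "exact_at (\<lambda>z. fsmul (Var z)) (piece es N) 0 (es' ! l)"
    using tb l unfolding tor_bound_def by simp
  moreover have "G ! l \<in> piece es N (es' ! l)" using G(1) l by (simp add: hgens_def)
  ultimately obtain b where b: "\<And>z. b z \<in> piece es N (es' ! l - 1)" "G ! l = (\<Sum>z\<in>UNIV. fsmul (Var z) (b z))"
    using piece_eq_sum_Var[OF N] by blast
  have "\<forall>z. \<exists>w. w \<in> free es' \<and> comb G w = b z"
  proof
    fix z
    have "b z \<in> comb G ` free es'" using b(1)[of z] hgensD(4)[OF G(1)] by (simp add: piece_def)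
    then show "\<exists>w. w \<in> free es' \<and> comb G w = b z" by auto
  qed
  then obtain w where w: "\<And>z. w z \<in> free es'" "\<And>z. comb G (w z) = b z" by metis
  define W where "W = (\<Sum>z\<in>UNIV. fsmul (Var z) (w z))"
  define u where "u = (\<lambda>k. if k = l then 1 else 0 :: ('v, 'k) mpoly)"
  have W0: "Poly_Mapping.lookup (W k) 0 = 0" for k
    by (simp add: W_def sum_apply lookup_sum lookup_Var_times_0)
  have "comb G W = G ! l"
    unfolding W_def comb_sum comb_fsmul w(2) b(2) ..
  moreover have "comb G u = G ! l"
    unfolding u_def using l hgensD(1)[OF G(1)] by (intro comb_unit) simp
  ultimately have "comb G (W - u) = 0" by (simp add: comb_diff)
  moreover have "W - u \<in> free es'"
    using w(1) l by (auto simp: W_def free_def u_def sum_apply)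
  ultimately have "Poly_Mapping.lookup ((W - u) l) 0 = 0"
    using G(2) unfolding min_syz_def syz_def by blast
  then show False using W0[of l] by (simp add: u_def lookup_minus)
qed

section \<open>Minimal generators\<close>

lemma kspan_hvec:
  fixes es :: "int list"
  shows "\<exists>T :: ('v::finite, 'k::field) fvec set. finite T \<and> {v. hvec es j v} \<subseteq> module.span kscale T"
proof -
  interpret V: vector_space "kscale :: 'k \<Rightarrow> ('v, 'k) fvec \<Rightarrow> _" by (rule vector_space_kscale)
  define e where "e = (\<lambda>(l :: nat, m) k. if k = l then Poly_Mapping.single m 1 else 0 :: ('v, 'k) mpoly)"
  define I where "I = (SIGMA l:{..<length es}. {m :: 'v \<Rightarrow>\<^sub>0 nat. int (mon_degree m) = j - es ! l})"
  have I: "finite I" by (simp add: I_def finite_mon_degree_int)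
  have "v \<in> V.span (e ` I)" if v: "hvec es j v" for v :: "('v, 'k) fvec"
  proof -
    have "v = (\<Sum>p\<in>I. kscale (Poly_Mapping.lookup (v (fst p)) (snd p)) (e p))"
    proof
      fix k
      have "(\<Sum>p\<in>I. kscale (Poly_Mapping.lookup (v (fst p)) (snd p)) (e p)) k
          = (\<Sum>(l, m)\<in>I. if k = l then Poly_Mapping.single m (Poly_Mapping.lookup (v l) m) else 0)"
        unfolding sum_apply
        by (intro sum.cong refl) (auto simp: kscale_def e_def mult_single)
      also have "\<dots> = (\<Sum>l<length es. \<Sum>m\<in>{m. int (mon_degree m) = j - es ! l}.
          if k = l then Poly_Mapping.single m (Poly_Mapping.lookup (v l) m) else 0)"
        unfolding I_def by (rule sum.Sigma[symmetric]) (simp_all add: finite_mon_degree_int)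
      also have "\<dots> = (\<Sum>l<length es. if k = l then hcomp (j - es ! l) (v l) else 0)"
        by (intro sum.cong refl) (simp add: hcomp_def)
      also have "\<dots> = v k"
        using v by (auto simp: hvec_def free_def hcomp_homogeneous)
      finally show "v k = (\<Sum>p\<in>I. kscale (Poly_Mapping.lookup (v (fst p)) (snd p)) (e p)) k" by simp
    qed
    also have "\<dots> \<in> V.span (e ` I)"
      by (intro V.span_sum V.span_scale V.span_base imageI)
    finally show ?thesis .
  qed
  then show ?thesis using I by (intro exI[of _ "e ` I"]) blast
qed

text \<open>A basis of the piece over the field is finite, because it lies in a space spanned by
  finitely many monomial vectors; it spans over the polynomial ring all the more.\<close>

lemma piece_finite_span:
  fixes N :: "('v::finite, 'k::field) fvec set"
  shows "\<exists>B. finite B \<and> B \<subseteq> piece es N j \<and> piece es N j \<subseteq> module.span fsmul B"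
proof -
  interpret V: vector_space "kscale :: 'k \<Rightarrow> ('v, 'k) fvec \<Rightarrow> _" by (rule vector_space_kscale)
  interpret S: Modules.module "fsmul :: ('v, 'k) mpoly \<Rightarrow> _" by (rule module_fsmul)
  obtain B where B: "B \<subseteq> piece es N j" "V.independent B" "piece es N j \<subseteq> V.span B"
    by (rule V.maximal_independent_subset)
  obtain T :: "('v, 'k) fvec set" where T: "finite T" "{v. hvec es j v} \<subseteq> V.span T"
    using kspan_hvec by blast
  have "B \<subseteq> V.span T" using B(1) T(2) by (auto simp: piece_def)
  then have "finite B" using V.independent_span_bound[OF T(1) B(2)] by blast
  moreover have "V.span B \<subseteq> S.span B"
  proof (rule V.span_minimal)
    show "B \<subseteq> S.span B" by (rule S.span_superset)
    show "V.subspace (S.span B)"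
      by (rule V.subspaceI) (simp_all only: kscale_def S.span_zero S.span_add S.span_scale)
  qed
  ultimately show ?thesis using B by blast
qed

lemma hvec_low:
  assumes "hvec es j v" "\<forall>e\<in>set es. j < e"
  shows "v = 0"
proof
  fix l
  show "v l = 0 l"
  proof (cases "l < length es")
    case True
    then have "homogeneous (j - es ! l) (v l)" "j - es ! l < 0" using assms by (auto simp: hvec_def)
    then have "Poly_Mapping.keys (v l) = {}" by (force simp: homogeneous_def)
    then show ?thesis by simp
  qed (use assms in \<open>simp add: hvec_def free_def\<close>)
qed

lemma sum_gcomp:
  fixes v :: "('v::finite, 'k::field) fvec"
  assumes "v \<in> free es"
  shows "\<exists>J. finite J \<and> (\<Sum>j\<in>J. gcomp es j v) = v"
proof -
  define J where "J = (\<Union>l<length es. (\<lambda>m. int (mon_degree m) + es ! l) ` Poly_Mapping.keys (v l))"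
  have J: "finite J" by (simp add: J_def)
  have "(\<Sum>j\<in>J. gcomp es j v) l = v l" for l
  proof (cases "l < length es")
    case True
    have "(\<Sum>j\<in>J. gcomp es j v) l = (\<Sum>j\<in>J. hcomp (j - es ! l) (v l))"
      using True by (simp add: sum_apply gcomp_def)
    also have "\<dots> = (\<Sum>d\<in>(\<lambda>j. j - es ! l) ` J. hcomp d (v l))"
      by (subst sum.reindex) (auto simp: inj_on_def)
    also have "\<dots> = v l"
    proof (rule sum_hcomp)
      show "(\<lambda>m. int (mon_degree m)) ` Poly_Mapping.keys (v l) \<subseteq> (\<lambda>j. j - es ! l) ` J"
      proof
        fix d assume "d \<in> (\<lambda>m. int (mon_degree m)) ` Poly_Mapping.keys (v l)"
        then have "d + es ! l \<in> J" using True by (auto simp: J_def)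
        then show "d \<in> (\<lambda>j. j - es ! l) ` J" by force
      qed
    qed (simp add: J)
    finally show ?thesis .
  next
    case False
    then show ?thesis using assms by (simp add: sum_apply gcomp_def free_def)
  qed
  then have "(\<Sum>j\<in>J. gcomp es j v) = v" by (rule ext)
  then show ?thesis using J by blast
qed

text \<open>Finite generation comes from the Koszul condition rather than from Hilbert's basis theorem:
  \<open>N\<close> is generated in degrees at most \<open>d\<close>, and its pieces are finite-dimensional.\<close>

lemma finite_homogeneous_span:
  fixes N :: "('v::finite, 'k::field) fvec set"
  assumes N: "graded_submodule es N" and tb: "tor_bound es N d"
  shows "\<exists>B. finite B \<and> B \<subseteq> (\<Union>j. piece es N j) \<and> module.span fsmul B = N"
proof -
  interpret S: Modules.module "fsmul :: ('v, 'k) mpoly \<Rightarrow> _" by (rule module_fsmul)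
  have sub: "S.subspace N" and free: "N \<subseteq> free es" and comp: "\<And>j v. v \<in> N \<Longrightarrow> gcomp es j v \<in> N"
    using N unfolding graded_submodule_def by auto
  \<comment> \<open>A lower bound for all shifts; the added 0 keeps \<open>Min\<close> meaningful
    when there are none.\<close>
  define j0 where "j0 = Min (insert 0 (set es))"
  have j0: "j0 \<le> e" if "e \<in> set es" for e using that by (simp add: j0_def)
  obtain Bs where Bs: "\<And>j. finite (Bs j)" "\<And>j. Bs j \<subseteq> piece es N j" "\<And>j. piece es N j \<subseteq> S.span (Bs j)"
    using piece_finite_span[of es N] by metis
  define B where "B = (\<Union>j\<in>{j0..d}. Bs j)"
  have fB: "finite B" by (simp add: B_def Bs(1))
  have BN: "B \<subseteq> (\<Union>j. piece es N j)" using Bs(2) by (auto simp: B_def)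
  have piece_B: "y \<in> S.span B" if "y \<in> piece es N j" for y j
    using that
  proof (induction "nat (j - j0)" arbitrary: j y rule: less_induct)
    case less
    consider "j < j0" | "j0 \<le> j" "j \<le> d" | "j0 \<le> j" "d < j" by linarith
    then show ?case
    proof cases
      case 1
      then have "y = 0" using hvec_low[of es j y] less.prems j0 by (force simp: piece_def)
      then show ?thesis using S.span_zero by simp
    next
      case 2
      then have "S.span (Bs j) \<subseteq> S.span B" by (intro S.span_mono) (auto simp: B_def)
      then show ?thesis using Bs(3) less.prems by blast
    next
      case 3
      then have "exact_at (\<lambda>z. fsmul (Var z)) (piece es N) 0 j"
        using tb unfolding tor_bound_def by simp
      from piece_eq_sum_Var[OF N this less.prems] obtain b where
        b: "\<And>z. b z \<in> piece es N (j - 1)" "y = (\<Sum>z\<in>UNIV. fsmul (Var z) (b z))" by blast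
      have "b z \<in> S.span B" for z
      \<comment> \<open>For \<open>j = j0\<close> the measure \<open>nat (j - j0)\<close> is already
        0 and cannot drop; the pieces below \<open>j0\<close> are zero instead.\<close>
      proof (cases "j - 1 < j0")
        case True
        then have "b z = 0" using hvec_low[of es "j - 1" "b z"] b(1)[of z] j0 by (force simp: piece_def)
        then show ?thesis using S.span_zero by simp
      next
        case False
        then show ?thesis using less.hyps[OF _ b(1)] by simp
      qed
      then show ?thesis unfolding b(2) by (intro S.span_sum S.span_scale)
    qed
  qed
  have "v \<in> S.span B" if v: "v \<in> N" for v
  proof -
    have "v \<in> free es" using v free by blast
    then obtain J where J: "finite J" "(\<Sum>j\<in>J. gcomp es j v) = v" using sum_gcomp by metis
    have "gcomp es j v \<in> S.span B" for j
      using comp[OF v] hvec_gcomp by (intro piece_B[of _ j]) (simp add: piece_def)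
    then have "(\<Sum>j\<in>J. gcomp es j v) \<in> S.span B" by (intro S.span_sum)
    then show ?thesis using J(2) by simp
  qed
  moreover have "S.span B \<subseteq> N"
    using BN by (intro S.span_minimal[OF _ sub]) (auto simp: piece_def)
  ultimately show ?thesis using fB BN by blast
qed

lemma comb_image_eq_span:
  fixes G :: "('v::finite, 'k::field) fvec list"
  assumes "distinct G" "length G = length es"
  shows "comb G ` free es = module.span fsmul (set G)"
proof -
  interpret S: Modules.module "fsmul :: ('v, 'k) mpoly \<Rightarrow> _" by (rule module_fsmul)
  have bij: "bij_betw (\<lambda>l. G ! l) {..<length G} (set G)"
    using assms(1) by (simp add: bij_betw_nth)
  have 1: "(\<Sum>v\<in>set G. fsmul (u v) v) \<in> comb G ` free es" for u
  proof -
    have "(\<Sum>v\<in>set G. fsmul (u v) v) = (\<Sum>l<length G. fsmul (u (G ! l)) (G ! l))"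
      using sum.reindex_bij_betw[OF bij, of "\<lambda>v. fsmul (u v) v"] by (rule sym)
    also have "\<dots> = comb G (\<lambda>l. if l < length es then u (G ! l) else 0)"
      unfolding comb_def using assms(2) by (intro sum.cong refl) auto
    finally show ?thesis by (auto simp: free_def)
  qed
  have 2: "comb G v \<in> S.span (set G)" for v
    unfolding comb_def by (intro S.span_sum S.span_scale S.span_base) auto
  show ?thesis
  proof (intro equalityI subsetI)
    show "y \<in> S.span (set G)" if "y \<in> comb G ` free es" for y using 2 that by (elim imageE) simp
    fix y assume "y \<in> S.span (set G)"
    then obtain u where "y = (\<Sum>v\<in>set G. fsmul (u v) v)"
      unfolding S.span_finite[OF finite_set] by (elim imageE)
    then show "y \<in> comb G ` free es" using 1 by simp
  qed
qed

lemma exists_min_gens: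
  fixes N :: "('v::finite, 'k::field) fvec set"
  assumes N: "graded_submodule es N" and tb: "tor_bound es N d"
  shows "\<exists>es' G. hgens es N es' G \<and> min_syz es' G"
proof -
  interpret S: Modules.module "fsmul :: ('v, 'k) mpoly \<Rightarrow> _" by (rule module_fsmul)
  let ?P = "\<lambda>B. finite B \<and> B \<subseteq> (\<Union>j. piece es N j) \<and> S.span B = N"
  obtain B where B: "?P B" and least: "\<And>B'. ?P B' \<Longrightarrow> card B \<le> card B'"
    using finite_homogeneous_span[OF N tb] ex_has_least_nat[of ?P _ card] by metis
  obtain G where G: "set G = B" "distinct G" using finite_distinct_list B by metis
  have "\<forall>g\<in>B. \<exists>j. g \<in> piece es N j" using B by blast
  then obtain deg where deg: "\<And>g. g \<in> B \<Longrightarrow> g \<in> piece es N (deg g)" by metis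
  define es' where "es' = map deg G"
  have len: "length G = length es'" by (simp add: es'_def)
  have gens: "hgens es N es' G"
    unfolding hgens_def
  proof (intro conjI allI impI)
    show "comb G ` free es' = N" using comb_image_eq_span[OF G(2) len] G(1) B by simp
    fix l assume "l < length es'"
    then have l: "l < length G" by (simp add: len)
    then have "G ! l \<in> piece es N (deg (G ! l))" using G(1) by (intro deg) auto
    then show "G ! l \<in> piece es N (es' ! l)" using l unfolding es'_def by (simp only: nth_map)
  qed (rule len)
  have "Poly_Mapping.lookup (v l) 0 = 0" if v: "v \<in> syz es' G" for v l
  proof (rule ccontr)
    assume nz: "Poly_Mapping.lookup (v l) 0 \<noteq> 0"
    have l: "l < length es'" using v nz by (cases "l < length es'") (auto simp: syz_def free_def)
    define a where "a = Poly_Mapping.lookup (v l) 0"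
    \<comment> \<open>In degree \<open>es' ! l\<close> the entry at \<open>l\<close> has degree 0,
      so it is exactly the constant term of \<open>v l\<close>, which is invertible.\<close>
    define w where "w = gcomp es' (es' ! l) v"
    have w: "w \<in> syz es' G"
      using graded_submodule_syz[OF gens] v unfolding graded_submodule_def w_def by blast
    have wl: "w l = Poly_Mapping.single 0 a"
    proof (rule poly_mapping_eqI)
      fix m show "Poly_Mapping.lookup (w l) m = Poly_Mapping.lookup (Poly_Mapping.single 0 a) m"
        using l by (simp add: w_def gcomp_def lookup_hcomp a_def lookup_single when_def)
    qed
    let ?g = "G ! l"
    let ?R = "\<Sum>k\<in>{..<length G} - {l}. fsmul (w k) (G ! k)"
    have "comb G w = fsmul (w l) ?g + ?R"
      unfolding comb_def using l len by (intro sum.remove) auto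
    then have eq: "fsmul (w l) ?g = - ?R" using w by (simp add: syz_def eq_neg_iff_add_eq_0)
    have "?g = fsmul (Poly_Mapping.single 0 (inverse a)) (fsmul (w l) ?g)"
      using nz by (simp add: wl mult_single a_def[symmetric] mult.assoc[symmetric])
    also have "\<dots> = fsmul (Poly_Mapping.single 0 (inverse a)) (- ?R)" unfolding eq ..
    also have "\<dots> \<in> S.span (B - {?g})"
    proof (intro S.span_scale S.span_neg S.span_sum S.span_base)
      fix k assume "k \<in> {..<length G} - {l}"
      then show "G ! k \<in> B - {?g}"
        using G l len by (auto simp: nth_eq_iff_index_eq)
    qed
    finally have g: "?g \<in> S.span (B - {?g})" .
    have gB: "?g \<in> B" using G(1) l len by auto
    have "insert ?g (B - {?g}) \<subseteq> S.span (B - {?g})"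
      using g S.span_superset[of "B - {?g}"] by blast
    moreover have "B - {?g} \<subseteq> S.span (insert ?g (B - {?g}))"
      using S.span_superset[of "insert ?g (B - {?g})"] by blast
    ultimately have "S.span (insert ?g (B - {?g})) = S.span (B - {?g})"
      unfolding S.span_eq by blast
    then have "?P (B - {?g})" using B gB by (auto simp: insert_absorb)
    then have "card B \<le> card (B - {?g})" by (rule least)
    then show False using card_Diff1_less[of B ?g] B gB by simp
  qed
  then have "min_syz es' G" by (simp add: min_syz_def)
  then show ?thesis using gens by blast
qed

section \<open>Minimal resolutions\<close>

text \<open>Makes an ideal a submodule of the free module with the single shift 0, so that the ideal
  and all later syzygies fall under the same lemmas.\<close>

definition emb :: "('v::finite, 'k::field) mpoly \<Rightarrow> ('v, 'k) fvec" where
  "emb f = (\<lambda>l. if l = 0 then f else 0)"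

definition fvec_of_vec :: "('v::finite, 'k::field) mpoly vec \<Rightarrow> ('v, 'k) fvec" where
  "fvec_of_vec v = (\<lambda>l. if l < dim_vec v then v $ l else 0)"

definition fcols :: "('v::finite, 'k::field) mpoly mat \<Rightarrow> ('v, 'k) fvec list" where
  "fcols D = map (\<lambda>k l. if l < dim_row D then D $$ (l, k) else 0) [0..<dim_col D]"

lemma emb_eq_iff: "emb f = emb g \<longleftrightarrow> f = g"
  unfolding emb_def fun_eq_iff by force

lemma emb_eq_0_iff: "emb f = 0 \<longleftrightarrow> f = 0"
  unfolding emb_def fun_eq_iff zero_fun_apply by force

lemma hvec_emb: "hvec [0] j (emb f) \<longleftrightarrow> homogeneous j f"
  by (simp add: hvec_def free_def emb_def)

lemma emb_apply_0: "v \<in> free [0] \<Longrightarrow> emb (v 0) = v"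
  by (auto simp: emb_def free_def fun_eq_iff)

lemma fvec_of_vec_image: "fvec_of_vec ` carrier_vec (length es) = free es"
proof (intro equalityI subsetI)
  fix w :: "('a, 'b) fvec" assume "w \<in> free es"
  then have "w = fvec_of_vec (vec (length es) w)"
    by (auto simp: fvec_of_vec_def free_def fun_eq_iff)
  then show "w \<in> fvec_of_vec ` carrier_vec (length es)" by (rule image_eqI) simp
qed (auto simp: fvec_of_vec_def free_def)

lemma inj_on_fvec_of_vec: "inj_on fvec_of_vec (carrier_vec n)"
proof (rule inj_onI)
  fix v w :: "('a, 'b) mpoly vec"
  assume vw: "v \<in> carrier_vec n" "w \<in> carrier_vec n" "fvec_of_vec v = fvec_of_vec w"
  show "v = w"
  proof (rule eq_vecI)
    fix i assume "i < dim_vec w"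
    then have i: "i < dim_vec v" "i < dim_vec w" using vw by auto
    have "fvec_of_vec v i = fvec_of_vec w i" by (simp only: vw(3))
    then show "v $ i = w $ i" using i by (simp only: fvec_of_vec_def if_True)
  qed (use vw in auto)
qed

lemma fvec_of_vec_eq_0_iff:
  assumes "v \<in> carrier_vec n"
  shows "fvec_of_vec v = 0 \<longleftrightarrow> v = 0\<^sub>v n"
proof -
  have "fvec_of_vec (0\<^sub>v n :: ('a, 'b) mpoly vec) = 0"
    by (auto simp: fvec_of_vec_def fun_eq_iff)
  then show ?thesis using inj_onD[OF inj_on_fvec_of_vec _ assms, of "0\<^sub>v n"] by force
qed

lemma length_fcols: "length (fcols D) = dim_col D"
  by (simp add: fcols_def)

lemma nth_fcols: "k < dim_col D \<Longrightarrow> fcols D ! k = (\<lambda>l. if l < dim_row D then D $$ (l, k) else 0)"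
  by (simp add: fcols_def fun_eq_iff)

lemma fvec_of_vec_mult:
  assumes "v \<in> carrier_vec (dim_col D)"
  shows "fvec_of_vec (D *\<^sub>v v) = comb (fcols D) (fvec_of_vec v)"
proof
  fix l
  have "comb (fcols D) (fvec_of_vec v) l = (\<Sum>k<dim_col D. v $ k * (if l < dim_row D then D $$ (l, k) else 0))"
    unfolding comb_apply length_fcols
    using assms by (intro sum.cong refl) (simp add: fvec_of_vec_def nth_fcols)
  also have "\<dots> = fvec_of_vec (D *\<^sub>v v) l"
    using assms by (simp add: fvec_of_vec_def scalar_prod_def atLeast0LessThan mult.commute)
  finally show "fvec_of_vec (D *\<^sub>v v) l = comb (fcols D) (fvec_of_vec v) l" ..
qed

lemma emb_augmentation:
  assumes "v \<in> carrier_vec (length (gens R))"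
  shows "emb (augmentation (*) R v) = comb (map emb (gens R)) (fvec_of_vec v)"
proof
  fix l
  have "comb (map emb (gens R)) (fvec_of_vec v) l
      = (\<Sum>k<length (gens R). v $ k * (if l = 0 then gens R ! k else 0))"
    unfolding comb_apply length_map
    using assms by (intro sum.cong refl) (simp add: fvec_of_vec_def emb_def)
  also have "\<dots> = emb (augmentation (*) R v) l"
    by (simp add: emb_def augmentation_def)
  finally show "emb (augmentation (*) R v) l = comb (map emb (gens R)) (fvec_of_vec v) l" ..
qed

text \<open>Turns minimality of a resolution into a condition on constant terms of matrix
  entries.\<close>

lemma ideal_gen_range_Var: "ideal_gen (range Var) = {f :: ('v::finite, 'k::field) mpoly. Poly_Mapping.lookup f 0 = 0}"
proof -
  interpret I: Modules.module "(*) :: ('v, 'k) mpoly \<Rightarrow> _" by (rule module_times)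
  show ?thesis
    unfolding ideal_gen_def
  proof (intro equalityI subsetI)
    have sub: "I.subspace {f. Poly_Mapping.lookup f 0 = 0}"
      by (intro I.subspaceI) (simp_all add: lookup_add lookup_times_0)
    fix f :: "('v, 'k) mpoly" assume "f \<in> I.span (range Var)"
    moreover have "range Var \<subseteq> {f :: ('v, 'k) mpoly. Poly_Mapping.lookup f 0 = 0}"
      using lookup_Var_0 by auto
    ultimately show "f \<in> {f. Poly_Mapping.lookup f 0 = 0}"
      using I.span_minimal[OF _ sub] by blast
  next
    fix f :: "('v, 'k) mpoly" assume f: "f \<in> {f. Poly_Mapping.lookup f 0 = 0}"
    have "Poly_Mapping.single m (Poly_Mapping.lookup f m) \<in> I.span (range Var)"
      if m: "m \<in> Poly_Mapping.keys f" for m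
    proof -
      have "m \<noteq> 0" using f m by (auto simp: in_keys_iff)
      then obtain x where "Poly_Mapping.lookup m x \<noteq> 0" by (metis lookup_zero poly_mapping_eqI)
      then have "m = (m - Poly_Mapping.single x 1) + Poly_Mapping.single x 1" by (intro split_single) simp
      then have "Poly_Mapping.single m (Poly_Mapping.lookup f m)
          = Poly_Mapping.single (m - Poly_Mapping.single x 1) (Poly_Mapping.lookup f m) * Var x"
        unfolding Var_def mult_single by simp
      then show ?thesis by (simp only: I.span_scale[OF I.span_base[OF rangeI]])
    qed
    then have "(\<Sum>m\<in>Poly_Mapping.keys f. Poly_Mapping.single m (Poly_Mapping.lookup f m)) \<in> I.span (range Var)"
      by (rule I.span_sum)
    then show "f \<in> I.span (range Var)" by (simp only: poly_mapping_sum_single)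
  qed
qed

section \<open>Resolutions read as iterated syzygies\<close>

definition grading :: "('v::finite, 'k::field) mpoly set \<Rightarrow> int \<Rightarrow> ('v, 'k) mpoly set" where
  "grading J j = {f \<in> J. homogeneous j f}"

text \<open>List \<open>i\<close> holds the images of the basis vectors of \<open>F_i\<close>. The
  augmentation takes index 0, whence the offset between \<open>columns\<close> and
  \<open>differential\<close>.\<close>

fun columns :: "('v::finite, 'k::field, ('v, 'k) mpoly) graded_complex \<Rightarrow> nat \<Rightarrow> ('v, 'k) fvec list" where
  "columns R 0 = map emb (gens R)"
| "columns R (Suc i) = fcols (differential R i)"

lemma graded_complexD:
  assumes "is_graded_complex (grading J) R"
  shows "length (gens R) = length (shifts R 0)"
    "\<And>l. l < length (shifts R 0) \<Longrightarrow> gens R ! l \<in> J"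
    "\<And>l. l < length (shifts R 0) \<Longrightarrow> homogeneous (shifts R 0 ! l) (gens R ! l)"
    "\<And>i. differential R i \<in> carrier_mat (length (shifts R i)) (length (shifts R (Suc i)))"
    "\<And>i l k. l < length (shifts R i) \<Longrightarrow> k < length (shifts R (Suc i)) \<Longrightarrow>
      homogeneous (shifts R (Suc i) ! k - shifts R i ! l) (differential R i $$ (l, k))"
  using assms unfolding is_graded_complex_def grading_def by auto

lemma image_augmentation_iff:
  fixes R :: "('v::finite, 'k::field, ('v, 'k) mpoly) graded_complex"
  assumes R: "is_graded_complex (grading J) R"
  shows "augmentation (*) R ` free_mod R 0 = J \<longleftrightarrow> hgens [0] (emb ` J) (shifts R 0) (columns R 0)"
proof -
  note D = graded_complexD[OF R]
  have "comb (columns R 0) ` free (shifts R 0) = emb ` augmentation (*) R ` free_mod R 0"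
    unfolding fvec_of_vec_image[symmetric] image_image free_mod_def
    using D(1) by (intro image_cong refl) (simp add: emb_augmentation)
  moreover have "inj (emb :: ('v, 'k) mpoly \<Rightarrow> _)" by (rule injI) (simp only: emb_eq_iff)
  ultimately have iff: "augmentation (*) R ` free_mod R 0 = J \<longleftrightarrow> comb (columns R 0) ` free (shifts R 0) = emb ` J"
    by (simp only: inj_image_eq_iff)
  have hv: "hvec [0] (shifts R 0 ! l) (columns R 0 ! l)" if "l < length (shifts R 0)" for l
    using D(1) D(3)[OF that] that by (simp add: hvec_emb)
  have len: "length (columns R 0) = length (shifts R 0)" using D(1) by simp
  show ?thesis
    unfolding iff
  proof
    assume im: "comb (columns R 0) ` free (shifts R 0) = emb ` J"
    show "hgens [0] (emb ` J) (shifts R 0) (columns R 0)" by (rule hgensI) (fact len, fact hv, fact im)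
  qed (rule hgensD(4))
qed

text \<open>\<open>P\<close> stands for the kernel condition, which is stated with the augmentation
  at step 0 and with the previous differential afterwards; one lemma thus serves both.\<close>

lemma exact_differential_iff:
  fixes R :: "('v::finite, 'k::field, ('v, 'k) mpoly) graded_complex"
  assumes R: "is_graded_complex (grading J) R"
    and ker: "\<And>v. v \<in> free_mod R i \<Longrightarrow> P v \<longleftrightarrow> comb (columns R i) (fvec_of_vec v) = 0"
  shows "(*\<^sub>v) (differential R i) ` free_mod R (Suc i) = {v \<in> free_mod R i. P v}
    \<longleftrightarrow> hgens (shifts R i) (syz (shifts R i) (columns R i)) (shifts R (Suc i)) (columns R (Suc i))"
proof -
  note D = graded_complexD[OF R]
  let ?D = "differential R i"
  have dim: "dim_row ?D = length (shifts R i)" "dim_col ?D = length (shifts R (Suc i))"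
    using D(4)[of i] by auto
  have im: "comb (columns R (Suc i)) ` free (shifts R (Suc i)) = fvec_of_vec ` (*\<^sub>v) ?D ` free_mod R (Suc i)"
    unfolding fvec_of_vec_image[symmetric] image_image free_mod_def
    using dim by (intro image_cong refl) (simp add: fvec_of_vec_mult)
  have ker': "syz (shifts R i) (columns R i) = fvec_of_vec ` {v \<in> free_mod R i. P v}"
  proof (intro equalityI subsetI)
    fix w assume "w \<in> syz (shifts R i) (columns R i)"
    then have w: "w \<in> free (shifts R i)" "comb (columns R i) w = 0" by (auto simp: syz_def)
    then obtain v where "v \<in> free_mod R i" "w = fvec_of_vec v"
      unfolding free_mod_def fvec_of_vec_image[symmetric] by auto
    then show "w \<in> fvec_of_vec ` {v \<in> free_mod R i. P v}" using ker w(2) by auto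
  next
    fix w assume "w \<in> fvec_of_vec ` {v \<in> free_mod R i. P v}"
    then obtain v where v: "v \<in> free_mod R i" "w = fvec_of_vec v" "P v" by auto
    then have "w \<in> free (shifts R i)"
      unfolding free_mod_def fvec_of_vec_image[symmetric] by auto
    then show "w \<in> syz (shifts R i) (columns R i)" using v ker by (simp add: syz_def)
  qed
  have sub: "(*\<^sub>v) ?D ` free_mod R (Suc i) \<subseteq> free_mod R i" "{v \<in> free_mod R i. P v} \<subseteq> free_mod R i"
    using D(4)[of i] unfolding free_mod_def by auto
  have iff: "(*\<^sub>v) ?D ` free_mod R (Suc i) = {v \<in> free_mod R i. P v} \<longleftrightarrow>
      comb (columns R (Suc i)) ` free (shifts R (Suc i)) = syz (shifts R i) (columns R i)"
    unfolding im ker'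
    by (rule inj_on_image_eq_iff[symmetric, OF inj_on_fvec_of_vec sub[unfolded free_mod_def], folded free_mod_def])
  have hv: "hvec (shifts R i) (shifts R (Suc i) ! k) (columns R (Suc i) ! k)"
    if k: "k < length (shifts R (Suc i))" for k
    using D(5)[OF _ k] dim k by (simp add: nth_fcols hvec_def free_def)
  have len: "length (columns R (Suc i)) = length (shifts R (Suc i))"
    using dim by (simp add: length_fcols)
  show ?thesis
    unfolding iff
  proof
    assume im: "comb (columns R (Suc i)) ` free (shifts R (Suc i)) = syz (shifts R i) (columns R i)"
    show "hgens (shifts R i) (syz (shifts R i) (columns R i)) (shifts R (Suc i)) (columns R (Suc i))"
      by (rule hgensI) (fact len, fact hv, fact im)
  qed (rule hgensD(4))
qed

lemma all_nat_Suc_iff: "(\<forall>i. P i) \<longleftrightarrow> P 0 \<and> (\<forall>i. P (Suc i))"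
  by (metis not0_implies_Suc)

text \<open>Exactness means that each list of columns generates the syzygies of the preceding list.
  In this form the results on generators and syzygies apply at every step.\<close>

lemma minimal_resolution_iff:
  fixes R :: "('v::finite, 'k::field, ('v, 'k) mpoly) graded_complex"
  shows "minimal_graded_free_resolution (*) J (grading J) R \<longleftrightarrow>
    is_graded_complex (grading J) R \<and>
    hgens [0] (emb ` J) (shifts R 0) (columns R 0) \<and>
    (\<forall>i. hgens (shifts R i) (syz (shifts R i) (columns R i)) (shifts R (Suc i)) (columns R (Suc i))) \<and>
    (\<forall>i. \<forall>l<length (shifts R i). \<forall>k<length (shifts R (Suc i)).
      Poly_Mapping.lookup (differential R i $$ (l, k)) 0 = 0)"
proof (cases "is_graded_complex (grading J) R")
  case True
  note D = graded_complexD[OF True]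
  have "(*\<^sub>v) (differential R 0) ` free_mod R (Suc 0) = {v \<in> free_mod R 0. augmentation (*) R v = 0}
    \<longleftrightarrow> hgens (shifts R 0) (syz (shifts R 0) (columns R 0)) (shifts R (Suc 0)) (columns R (Suc 0))"
  proof (rule exact_differential_iff[OF True])
    fix v assume "v \<in> free_mod R 0"
    then have "comb (columns R 0) (fvec_of_vec v) = emb (augmentation (*) R v)"
      using D(1) by (simp add: free_mod_def emb_augmentation)
    then show "(augmentation (*) R v = 0) = (comb (columns R 0) (fvec_of_vec v) = 0)"
      by (simp only: emb_eq_0_iff)
  qed
  moreover have "(*\<^sub>v) (differential R (Suc i)) ` free_mod R (Suc (Suc i)) =
      {v \<in> free_mod R (Suc i). differential R i *\<^sub>v v = 0\<^sub>v (length (shifts R i))}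
    \<longleftrightarrow> hgens (shifts R (Suc i)) (syz (shifts R (Suc i)) (columns R (Suc i))) (shifts R (Suc (Suc i))) (columns R (Suc (Suc i)))" for i
  proof (rule exact_differential_iff[OF True])
    fix v assume v: "v \<in> free_mod R (Suc i)"
    then have "comb (columns R (Suc i)) (fvec_of_vec v) = fvec_of_vec (differential R i *\<^sub>v v)"
      using D(4)[of i] by (simp add: free_mod_def fvec_of_vec_mult)
    moreover have "differential R i *\<^sub>v v \<in> carrier_vec (length (shifts R i))"
      using v mult_mat_vec_carrier[OF D(4)] by (simp add: free_mod_def)
    ultimately show "(differential R i *\<^sub>v v = 0\<^sub>v (length (shifts R i))) = (comb (columns R (Suc i)) (fvec_of_vec v) = 0)"
      by (simp only: fvec_of_vec_eq_0_iff)
  qed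
  ultimately have "graded_free_resolution (*) J (grading J) R \<longleftrightarrow>
    hgens [0] (emb ` J) (shifts R 0) (columns R 0) \<and>
    (\<forall>i. hgens (shifts R i) (syz (shifts R i) (columns R i)) (shifts R (Suc i)) (columns R (Suc i)))"
    unfolding graded_free_resolution_def One_nat_def image_augmentation_iff[OF True]
    all_nat_Suc_iff[of "\<lambda>i. hgens (shifts R i) (syz (shifts R i) (columns R i)) (shifts R (Suc i)) (columns R (Suc i))"]
    using True by simp
  then show ?thesis
    using True unfolding minimal_graded_free_resolution_def ideal_gen_range_Var by simp
next
  case False
  then show ?thesis unfolding minimal_graded_free_resolution_def graded_free_resolution_def by simp
qed

section \<open>Squarefree powers of edge ideals\<close>

definition monomial_span :: "('v \<Rightarrow>\<^sub>0 nat) set \<Rightarrow> ('v::finite, 'k::field) mpoly set" where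
  "monomial_span U = {f. Poly_Mapping.keys f \<subseteq> U}"

definition up_closed :: "('v \<Rightarrow>\<^sub>0 nat) set \<Rightarrow> bool" where
  "up_closed U \<longleftrightarrow> (\<forall>a. \<forall>m\<in>U. a + m \<in> U)"

lemma subspace_monomial_span:
  assumes "up_closed U"
  shows "Modules.module.subspace (*) (monomial_span U :: ('v::finite, 'k::field) mpoly set)"
proof -
  interpret I: Modules.module "(*) :: ('v, 'k) mpoly \<Rightarrow> _" by (rule module_times)
  show ?thesis
  proof (rule I.subspaceI)
    fix f g :: "('v, 'k) mpoly"
    show "f + g \<in> monomial_span U" if "f \<in> monomial_span U" "g \<in> monomial_span U"
      using that keys_add[of f g] unfolding monomial_span_def by blast
    show "f * g \<in> monomial_span U" if "g \<in> monomial_span U"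
      using that keys_mult[of f g] assms unfolding monomial_span_def up_closed_def by blast
  qed (simp add: monomial_span_def)
qed

lemma monomial_span_subset:
  assumes "Modules.module.subspace (*) I" "\<And>m. m \<in> U \<Longrightarrow> Poly_Mapping.single m 1 \<in> I"
  shows "monomial_span U \<subseteq> (I :: ('v::finite, 'k::field) mpoly set)"
proof
  interpret I: Modules.module "(*) :: ('v, 'k) mpoly \<Rightarrow> _" by (rule module_times)
  fix f :: "('v, 'k) mpoly" assume f: "f \<in> monomial_span U"
  have "Poly_Mapping.single m (Poly_Mapping.lookup f m) \<in> I" if "m \<in> Poly_Mapping.keys f" for m
  proof -
    have "Poly_Mapping.single 0 (Poly_Mapping.lookup f m) * Poly_Mapping.single m 1 \<in> I"
      using f that by (intro I.subspace_scale[OF assms(1)] assms(2)) (auto simp: monomial_span_def)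
    then show ?thesis by (simp add: mult_single)
  qed
  then have "(\<Sum>m\<in>Poly_Mapping.keys f. Poly_Mapping.single m (Poly_Mapping.lookup f m)) \<in> I"
    by (rule I.subspace_sum[OF assms(1)])
  then show "f \<in> I" by (simp only: poly_mapping_sum_single)
qed

lemma ideal_gen_eq_monomial_span:
  fixes B :: "('v::finite, 'k::field) mpoly set"
  assumes "up_closed U" "B \<subseteq> monomial_span U"
    and "\<And>m. m \<in> U \<Longrightarrow> \<exists>a b. m = a + b \<and> Poly_Mapping.single b 1 \<in> B"
  shows "ideal_gen B = monomial_span U"
proof -
  interpret I: Modules.module "(*) :: ('v, 'k) mpoly \<Rightarrow> _" by (rule module_times)
  show ?thesis
    unfolding ideal_gen_def
  proof
    show "I.span B \<subseteq> monomial_span U"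
      by (rule I.span_minimal[OF assms(2) subspace_monomial_span[OF assms(1)]])
    show "monomial_span U \<subseteq> I.span B"
    proof (rule monomial_span_subset[OF I.subspace_span])
      fix m assume "m \<in> U"
      then obtain a b where ab: "m = a + b" "Poly_Mapping.single b 1 \<in> B" using assms(3) by blast
      have "Poly_Mapping.single a 1 * Poly_Mapping.single b 1 \<in> I.span B"
        by (intro I.span_scale I.span_base ab(2))
      then show "Poly_Mapping.single m 1 \<in> I.span B" by (simp add: ab(1) mult_single)
    qed
  qed
qed

text \<open>Exponents of the monomials in the \<open>s\<close>-th power of the edge ideal. The base
  case \<open>UNIV\<close> supplies the arbitrary cofactor and agrees with
  \<open>ideal_power\<close>.\<close>

fun edge_sums :: "'v::finite set set \<Rightarrow> nat \<Rightarrow> ('v \<Rightarrow>\<^sub>0 nat) set" where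
  "edge_sums E 0 = UNIV"
| "edge_sums E (Suc s) = {ind e + m | e m. e \<in> E \<and> m \<in> edge_sums E s}"

lemma up_closed_edge_sums: "up_closed (edge_sums E s)"
proof (induction s)
  case (Suc s)
  show ?case
    unfolding up_closed_def
  proof (intro allI ballI)
    fix a n assume "n \<in> edge_sums E (Suc s)"
    then obtain e m where em: "n = ind e + m" "e \<in> E" "m \<in> edge_sums E s" by auto
    then have "a + m \<in> edge_sums E s" using Suc unfolding up_closed_def by blast
    moreover have "a + n = ind e + (a + m)" unfolding em(1) by (rule add.left_commute)
    ultimately show "a + n \<in> edge_sums E (Suc s)" using em(2) by auto
  qed
qed (simp add: up_closed_def)

lemma edge_monomial:
  assumes "simple_graph E"
  shows "{Var x * Var y | x y. {x, y} \<in> E} = (\<lambda>e. Poly_Mapping.single (ind e) 1 :: ('v::finite, 'k::field) mpoly) ` E"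
proof -
  have eq: "Var x * Var y = (Poly_Mapping.single (ind {x, y}) 1 :: ('v, 'k) mpoly)" if "{x, y} \<in> E" for x y
  proof -
    have "x \<noteq> y" using assms that by (force simp: simple_graph_def)
    then show ?thesis by (simp add: Var_def mult_single ind_def)
  qed
  show ?thesis
  proof (intro equalityI subsetI)
    fix f :: "('v, 'k) mpoly" assume "f \<in> {Var x * Var y | x y. {x, y} \<in> E}"
    then obtain x y where "f = Var x * Var y" "{x, y} \<in> E" by auto
    then show "f \<in> (\<lambda>e. Poly_Mapping.single (ind e) 1) ` E" using eq by auto
  next
    fix f :: "('v, 'k) mpoly" assume "f \<in> (\<lambda>e. Poly_Mapping.single (ind e) 1) ` E"
    then obtain e where e: "f = Poly_Mapping.single (ind e) 1" "e \<in> E" by auto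
    then obtain x y where xy: "e = {x, y}" using assms by (auto simp: simple_graph_def card_2_iff)
    then have "f = Var x * Var y" using eq[of x y] e by simp
    then show "f \<in> {Var x * Var y | x y. {x, y} \<in> E}" using e(2) xy by blast
  qed
qed

lemma edge_ideal_eq:
  assumes "simple_graph E"
  shows "edge_ideal E = (monomial_span (edge_sums E 1) :: ('v::finite, 'k::field) mpoly set)"
  unfolding edge_ideal_def edge_monomial[OF assms]
proof (rule ideal_gen_eq_monomial_span)
  show "up_closed (edge_sums E 1)" by (rule up_closed_edge_sums)
  show "(\<lambda>e. Poly_Mapping.single (ind e) 1 :: ('v, 'k) mpoly) ` E \<subseteq> monomial_span (edge_sums E 1)"
  proof
    fix f :: "('v, 'k) mpoly" assume "f \<in> (\<lambda>e. Poly_Mapping.single (ind e) 1) ` E"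
    then obtain e where e: "e \<in> E" "f = Poly_Mapping.single (ind e) 1" by auto
    then have "ind e + 0 \<in> edge_sums E 1" unfolding One_nat_def edge_sums.simps by blast
    then show "f \<in> monomial_span (edge_sums E 1)" using e by (simp add: monomial_span_def)
  qed
  fix m assume "m \<in> edge_sums E 1"
  then obtain e a where "e \<in> E" "m = ind e + a" by auto
  then show "\<exists>a b. m = a + b \<and> Poly_Mapping.single b 1 \<in> (\<lambda>e. Poly_Mapping.single (ind e) 1 :: ('v, 'k) mpoly) ` E"
    by (intro exI[of _ a] exI[of _ "ind e"]) (auto simp: add.commute)
qed

lemma ideal_power_eq:
  assumes "simple_graph E"
  shows "ideal_power (edge_ideal E) s = (monomial_span (edge_sums E s) :: ('v::finite, 'k::field) mpoly set)"
proof (induction s)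
  case 0
  then show ?case by (simp add: monomial_span_def)
next
  case (Suc s)
  show ?case
    unfolding ideal_power.simps Suc unfolding edge_ideal_eq[OF assms]
  proof (rule ideal_gen_eq_monomial_span)
    show "up_closed (edge_sums E (Suc s))" by (rule up_closed_edge_sums)
    show "{a * b | a b. a \<in> monomial_span (edge_sums E 1) \<and> b \<in> monomial_span (edge_sums E s)}
        \<subseteq> (monomial_span (edge_sums E (Suc s)) :: ('v, 'k) mpoly set)"
    proof
      fix f :: "('v, 'k) mpoly"
      assume "f \<in> {a * b | a b. a \<in> monomial_span (edge_sums E 1) \<and> b \<in> monomial_span (edge_sums E s)}"
      then obtain a b where ab: "f = a * b" "Poly_Mapping.keys a \<subseteq> edge_sums E 1" "Poly_Mapping.keys b \<subseteq> edge_sums E s"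
        unfolding monomial_span_def by auto
      have "m \<in> edge_sums E (Suc s)" if m: "m \<in> Poly_Mapping.keys f" for m
      proof -
        obtain p q where pq: "m = p + q" "p \<in> edge_sums E 1" "q \<in> edge_sums E s"
          using m ab keys_mult[of a b] by blast
        then obtain e r where er: "p = ind e + r" "e \<in> E" by auto
        have "r + q \<in> edge_sums E s" using up_closed_edge_sums pq(3) unfolding up_closed_def by blast
        moreover have "m = ind e + (r + q)" unfolding pq(1) er(1) by (rule add.assoc)
        ultimately show ?thesis using er(2) by auto
      qed
      then show "f \<in> monomial_span (edge_sums E (Suc s))" unfolding monomial_span_def by blast
    qed
    fix m assume "m \<in> edge_sums E (Suc s)"
    then obtain e n where en: "m = ind e + n" "e \<in> E" "n \<in> edge_sums E s" by auto
    have "ind e + 0 \<in> edge_sums E 1" using en(2) unfolding One_nat_def edge_sums.simps by blast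
    then have "Poly_Mapping.single (ind e) 1 \<in> (monomial_span (edge_sums E 1) :: ('v, 'k) mpoly set)"
      by (simp add: monomial_span_def)
    moreover have "Poly_Mapping.single n 1 \<in> (monomial_span (edge_sums E s) :: ('v, 'k) mpoly set)"
      using en(3) by (simp add: monomial_span_def)
    moreover have "Poly_Mapping.single m 1 = (Poly_Mapping.single (ind e) 1 * Poly_Mapping.single n 1 :: ('v, 'k) mpoly)"
      by (simp add: en(1) mult_single)
    ultimately have "Poly_Mapping.single m 1 \<in>
      {a * b | a b :: ('v, 'k) mpoly. a \<in> monomial_span (edge_sums E 1) \<and> b \<in> monomial_span (edge_sums E s)}"
      by blast
    then show "\<exists>a b. m = a + b \<and> Poly_Mapping.single b 1 \<in>
      {a * b | a b :: ('v, 'k) mpoly. a \<in> monomial_span (edge_sums E 1) \<and> b \<in> monomial_span (edge_sums E s)}"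
      by (intro exI[of _ 0] exI[of _ m]) simp
  qed
qed

text \<open>When no exponent exceeds 1, the edges in a product can neither repeat nor meet.\<close>

lemma squarefree_edge_sums:
  assumes "m \<in> edge_sums E s" "\<And>x. Poly_Mapping.lookup m x \<le> 1" "simple_graph E"
  shows "\<exists>M. matching E M \<and> card M = s \<and> \<Union>M \<subseteq> Poly_Mapping.keys m"
  using assms(1,2)
proof (induction s arbitrary: m)
  case 0
  then show ?case by (intro exI[of _ "{}"]) (simp add: matching_def)
next
  case (Suc s)
  then obtain e n where en: "m = ind e + n" "e \<in> E" "n \<in> edge_sums E s" by auto
  have l: "Poly_Mapping.lookup m x = (if x \<in> e then 1 else 0) + Poly_Mapping.lookup n x" for x
    by (simp add: en(1) lookup_add lookup_ind)
  have "Poly_Mapping.lookup n x \<le> 1" for x using Suc.prems(2)[of x] l[of x] by simp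
  from Suc.IH[OF en(3) this] obtain M where M: "matching E M" "card M = s" "\<Union>M \<subseteq> Poly_Mapping.keys n" by blast
  have keys: "Poly_Mapping.keys m = e \<union> Poly_Mapping.keys n"
    by (auto simp: in_keys_iff l split: if_splits)
  have disj: "e \<inter> Poly_Mapping.keys n = {}"
  proof -
    have "x \<notin> Poly_Mapping.keys n" if "x \<in> e" for x
      using Suc.prems(2)[of x] l[of x] that by (simp add: in_keys_iff)
    then show ?thesis by blast
  qed
  then have eM: "e \<inter> \<Union>M = {}" using M(3) by blast
  have "e \<noteq> {}" using assms(3) en(2) by (force simp: simple_graph_def)
  then have "e \<notin> M" using eM by blast
  then have "card (insert e M) = Suc s" using M(2) by simp
  moreover have "matching E (insert e M)"
    unfolding matching_def
  proof
    show "insert e M \<subseteq> E" using M(1) en(2) by (simp add: matching_def)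
    have "disjnt e e'" "disjnt e' e" if "e' \<in> M" for e' using eM that unfolding disjnt_def by blast+
    then show "pairwise disjnt (insert e M)"
      using M(1) by (simp add: matching_def pairwise_insert)
  qed
  moreover have "\<Union>(insert e M) \<subseteq> Poly_Mapping.keys m" using M(3) keys by blast
  ultimately show ?case by blast
qed

lemma matching_edge_sums:
  assumes "finite M" "matching E M"
  shows "ind (\<Union>M) \<in> edge_sums E (card M)"
  using assms
proof (induction M rule: finite_induct)
  case (insert e M)
  have "matching E M" using insert.prems by (auto simp: matching_def pairwise_insert)
  moreover have "e \<inter> \<Union>M = {}"
  proof -
    have "e \<inter> e' = {}" if "e' \<in> M" for e'
      using insert.prems insert.hyps(2) that by (auto simp: matching_def pairwise_insert disjnt_def)
    then show ?thesis by blast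
  qed
  then have "ind (\<Union>(insert e M)) = ind e + ind (\<Union>M)"
    unfolding ind_def Union_insert by (intro sum.union_disjoint) auto
  moreover have "e \<in> E" using insert.prems by (simp add: matching_def)
  ultimately show ?case using insert.IH insert.hyps by auto
qed simp

text \<open>Only the support of \<open>m\<close> enters, which is what makes the complexes in
  non-squarefree multidegrees cones.\<close>

definition matching_monomials :: "'v::finite set set \<Rightarrow> nat \<Rightarrow> ('v \<Rightarrow>\<^sub>0 nat) set" where
  "matching_monomials E s = {m. \<exists>M. matching E M \<and> card M = s \<and> \<Union>M \<subseteq> Poly_Mapping.keys m}"

lemma up_closed_matching_monomials: "up_closed (matching_monomials E s)"
proof -
  have keys: "Poly_Mapping.keys m \<subseteq> Poly_Mapping.keys (a + m)" for a m :: "'a \<Rightarrow>\<^sub>0 nat"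
    by (auto simp: in_keys_iff lookup_add)
  show ?thesis
    unfolding up_closed_def
  proof (intro allI ballI)
    fix a m assume "m \<in> matching_monomials E s"
    then obtain M where "matching E M" "card M = s" "\<Union>M \<subseteq> Poly_Mapping.keys m"
      by (auto simp: matching_monomials_def)
    then show "a + m \<in> matching_monomials E s"
      unfolding matching_monomials_def using keys[of m a] by (intro CollectI exI[of _ M]) simp
  qed
qed

lemma squarefree_power_eq:
  assumes "simple_graph E"
  shows "squarefree_power (edge_ideal E) s = (monomial_span (matching_monomials E s) :: ('v::finite, 'k::field) mpoly set)"
  unfolding squarefree_power_def ideal_power_eq[OF assms]
proof (rule ideal_gen_eq_monomial_span[OF up_closed_matching_monomials])
  show "{f \<in> monomial_span (edge_sums E s). squarefree_monomial f}
      \<subseteq> (monomial_span (matching_monomials E s) :: ('v, 'k) mpoly set)"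
  proof
    fix f :: "('v, 'k) mpoly" assume "f \<in> {f \<in> monomial_span (edge_sums E s). squarefree_monomial f}"
    then obtain m where m: "f = Poly_Mapping.single m 1" "\<And>x. Poly_Mapping.lookup m x \<le> 1" "m \<in> edge_sums E s"
      unfolding squarefree_monomial_def monomial_span_def by auto
    then have "m \<in> matching_monomials E s"
      using squarefree_edge_sums[OF m(3) m(2) assms] by (simp add: matching_monomials_def)
    then show "f \<in> monomial_span (matching_monomials E s)" by (simp add: m(1) monomial_span_def)
  qed
  fix m assume "m \<in> matching_monomials E s"
  then obtain M where M: "matching E M" "card M = s" "\<Union>M \<subseteq> Poly_Mapping.keys m"
    by (auto simp: matching_monomials_def)
  have "ind (\<Union>M) \<in> edge_sums E s" using matching_edge_sums[OF finite M(1)] M(2) by simp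
  moreover have "squarefree_monomial (Poly_Mapping.single (ind (\<Union>M)) 1 :: ('v, 'k) mpoly)"
    unfolding squarefree_monomial_def by (intro exI[of _ "ind (\<Union>M)"]) (simp add: lookup_ind)
  ultimately have "Poly_Mapping.single (ind (\<Union>M)) 1 \<in>
      {f \<in> (monomial_span (edge_sums E s) :: ('v, 'k) mpoly set). squarefree_monomial f}"
    by (simp add: monomial_span_def)
  moreover have "m = (m - ind (\<Union>M)) + ind (\<Union>M)"
  proof (rule poly_mapping_eqI)
    fix x
    have "Poly_Mapping.lookup m x \<ge> 1" if "x \<in> \<Union>M"
      using M(3) that by (metis One_nat_def Suc_leI in_keys_iff neq0_conv subsetD)
    then show "Poly_Mapping.lookup m x = Poly_Mapping.lookup ((m - ind (\<Union>M)) + ind (\<Union>M)) x"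
      by (simp add: lookup_add lookup_minus lookup_ind)
  qed
  ultimately show "\<exists>a b. m = a + b \<and> Poly_Mapping.single b 1 \<in>
      {f \<in> (monomial_span (edge_sums E s) :: ('v, 'k) mpoly set). squarefree_monomial f}"
    by blast
qed

lemma matching_monomials_bipartite:
  assumes "bipartition E X Y"
  shows "matching_monomials E s = {m. matches E (Poly_Mapping.keys m \<inter> X) s (Poly_Mapping.keys m \<inter> Y)}"
  unfolding matching_monomials_def matching_iff_matches[OF assms] ..

section \<open>The regularity bound\<close>

lemma emb_zero: "emb 0 = 0"
  by (simp only: emb_eq_0_iff)

lemma emb_add: "emb f + emb g = emb (f + g)"
  by (auto simp: emb_def fun_eq_iff)

lemma fsmul_emb: "fsmul h (emb f) = emb (h * f)"
  by (auto simp: emb_def fun_eq_iff)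

lemma gcomp_emb: "gcomp [0] j (emb f) = emb (hcomp j f)"
  by (auto simp: emb_def gcomp_def fun_eq_iff)

lemma emb_in_free: "emb f \<in> free [0]"
  by (simp add: emb_def free_def)

lemma graded_submodule_emb:
  fixes U :: "('v::finite \<Rightarrow>\<^sub>0 nat) set"
  assumes "up_closed U"
  shows "graded_submodule [0] (emb ` (monomial_span U :: ('v, 'k::field) mpoly set))"
proof -
  interpret I: Modules.module "(*) :: ('v, 'k) mpoly \<Rightarrow> _" by (rule module_times)
  let ?J = "monomial_span U :: ('v, 'k) mpoly set"
  note sub = subspace_monomial_span[OF assms]
  have "Modules.module.subspace fsmul (emb ` ?J)"
    unfolding subspace_iff
  proof (intro conjI ballI allI)
    have "emb 0 \<in> emb ` ?J" by (rule imageI[OF I.subspace_0[OF sub]])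
    then show "0 \<in> emb ` ?J" by (simp only: emb_zero)
    fix v assume "v \<in> emb ` ?J"
    then obtain f where f: "v = emb f" "f \<in> ?J" by auto
    show "fsmul h v \<in> emb ` ?J" for h
      unfolding f(1) fsmul_emb by (intro imageI I.subspace_scale[OF sub] f(2))
    fix w assume "w \<in> emb ` ?J"
    then obtain g where g: "w = emb g" "g \<in> ?J" by auto
    show "v + w \<in> emb ` ?J"
      unfolding f(1) g(1) emb_add by (intro imageI I.subspace_add[OF sub] f(2) g(2))
  qed
  moreover have "gcomp [0] j v \<in> emb ` ?J" if v: "v \<in> emb ` ?J" for j v
  proof -
    obtain f where f: "v = emb f" "f \<in> ?J" using v by auto
    then have "hcomp j f \<in> ?J"
      by (auto simp: monomial_span_def in_keys_iff lookup_hcomp split: if_splits)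
    then show ?thesis unfolding f(1) gcomp_emb by (rule imageI)
  qed
  ultimately show ?thesis using emb_in_free unfolding graded_submodule_def by blast
qed

lemma tor_bound_emb:
  fixes J :: "('v::finite, 'k::field) mpoly set"
  assumes ex: "\<And>i j. int i + d < j \<Longrightarrow> exact_at (\<lambda>z f. Var z * f) (grading J) i j"
  shows "tor_bound [0] (emb ` J) d"
  unfolding tor_bound_def
proof (intro allI impI)
  fix i j assume ij: "int i + d < j"
  have piece: "v \<in> piece [0] (emb ` J) j \<longleftrightarrow> v 0 \<in> grading J j \<and> v = emb (v 0)" for v j
  proof
    assume "v \<in> piece [0] (emb ` J) j"
    then obtain f where f: "f \<in> J" "v = emb f" "hvec [0] j (emb f)" by (auto simp: piece_def)
    have "v 0 = f" by (simp add: f(2) emb_def)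
    then show "v 0 \<in> grading J j \<and> v = emb (v 0)" using f by (simp add: grading_def hvec_emb)
  next
    assume v: "v 0 \<in> grading J j \<and> v = emb (v 0)"
    have "v 0 \<in> grading J j" by (rule conjunct1[OF v])
    then have "emb (v 0) \<in> piece [0] (emb ` J) j" by (simp add: piece_def grading_def hvec_emb)
    then show "v \<in> piece [0] (emb ` J) j" by (simp only: conjunct2[OF v, symmetric])
  qed
  let ?kd = "kd (\<lambda>z. fsmul (Var z :: ('v, 'k) mpoly))"
  let ?kd' = "kd (\<lambda>z f :: ('v, 'k) mpoly. Var z * f)"
  show "exact_at (\<lambda>z. fsmul (Var z)) (piece [0] (emb ` J)) i j"
    unfolding exact_at_def
  proof (intro allI impI, elim conjE)
    fix c :: "'v set \<Rightarrow> ('v, 'k) fvec"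
    assume c: "\<forall>A. c A \<in> piece [0] (emb ` J) (j - int (card A))" "\<forall>A. card A \<noteq> i \<longrightarrow> c A = 0" "\<forall>A. ?kd c A = 0"
    have "\<forall>A. c A 0 \<in> grading J (j - int (card A))" using c(1) piece by blast
    moreover have "\<forall>A. card A \<noteq> i \<longrightarrow> c A 0 = 0" using c(2) by simp
    moreover have "\<forall>A. ?kd' (\<lambda>A. c A 0) A = 0" using c(3) by (simp flip: kd_fsmul_apply)
    ultimately obtain b where b: "\<forall>A. b A \<in> grading J (j - int (card A))"
      "\<forall>A. card A \<noteq> Suc i \<longrightarrow> b A = 0" "\<forall>A. ?kd' b A = c A 0"
      using ex[OF ij, unfolded exact_at_def, THEN spec, of "\<lambda>A. c A 0"] by blast
    show "\<exists>b. (\<forall>A. b A \<in> piece [0] (emb ` J) (j - int (card A))) \<and> (\<forall>A. card A \<noteq> Suc i \<longrightarrow> b A = 0) \<and>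
        (\<forall>A. ?kd b A = c A)"
    proof (intro exI[of _ "\<lambda>A. emb (b A)"] conjI allI impI)
      fix A :: "'v set"
      have "emb (b A) 0 = b A" by (simp add: emb_def)
      then show "emb (b A) \<in> piece [0] (emb ` J) (j - int (card A))"
        unfolding piece using b(1) by simp
      show "emb (b A) = 0" if "card A \<noteq> Suc i" unfolding emb_eq_0_iff using b(2) that by blast
      show "?kd (\<lambda>A. emb (b A)) A = c A"
      proof
        fix l
        show "?kd (\<lambda>A. emb (b A)) A l = c A l"
        proof (cases "l = 0")
          case True
          then show ?thesis unfolding kd_fsmul_apply using b(3) by (simp add: emb_def)
        next
          case False
          have "c A = emb (c A 0)" using c(1) piece by blast
          from fun_cong[OF this, of l] have "c A l = 0" using False by (simp add: emb_def)
          moreover have "?kd' (\<lambda>A. emb (b A) l) A = 0" using False by (simp add: kd_def emb_def)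
          ultimately show ?thesis unfolding kd_fsmul_apply by simp
        qed
      qed
    qed
  qed
qed

text \<open>By exactness a syzygy of step \<open>i\<close> is a combination of the columns of the
  next differential, whose entries have no constant term by minimality.\<close>

lemma min_syz_columns:
  fixes R :: "('v::finite, 'k::field, ('v, 'k) mpoly) graded_complex"
  assumes "minimal_graded_free_resolution (*) J (grading J) R"
  shows "min_syz (shifts R i) (columns R i)"
  unfolding min_syz_def
proof (intro ballI allI)
  note R = assms[unfolded minimal_resolution_iff]
  have G: "hgens (shifts R i) (syz (shifts R i) (columns R i)) (shifts R (Suc i)) (columns R (Suc i))"
    and D: "is_graded_complex (grading J) R"
    and min: "\<And>l k. l < length (shifts R i) \<Longrightarrow> k < length (shifts R (Suc i)) \<Longrightarrow>
      Poly_Mapping.lookup (differential R i $$ (l, k)) 0 = 0"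
    using R by auto
  have dim: "dim_row (differential R i) = length (shifts R i)" "dim_col (differential R i) = length (shifts R (Suc i))"
    using graded_complexD(4)[OF D, of i] by auto
  fix v l assume "v \<in> syz (shifts R i) (columns R i)"
  then obtain w where w: "v = comb (columns R (Suc i)) w"
    using hgensD(4)[OF G] by auto
  have "Poly_Mapping.lookup (w k * (columns R (Suc i) ! k) l) 0 = 0" if "k < length (columns R (Suc i))" for k
    using that min[of l k] by (intro lookup_times_0) (simp add: length_fcols dim nth_fcols)
  then show "Poly_Mapping.lookup (v l) 0 = 0"
    unfolding w comb_apply lookup_sum by (intro sum.neutral) simp
qed

text \<open>The syzygies of step \<open>i\<close> are generated by the basis of step
  \<open>Suc i\<close>, so their bound \<open>d + int i + 1\<close> is precisely the bound for the
  shifts there.\<close>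

lemma tor_bound_resolution:
  fixes R :: "('v::finite, 'k::field, ('v, 'k) mpoly) graded_complex"
  assumes R: "minimal_graded_free_resolution (*) J (grading J) R"
    and J: "graded_submodule [0] (emb ` J)" "tor_bound [0] (emb ` J) d"
  shows "(\<forall>e\<in>set (shifts R i). e \<le> d + int i) \<and> graded_submodule (shifts R i) (syz (shifts R i) (columns R i)) \<and>
    tor_bound (shifts R i) (syz (shifts R i) (columns R i)) (d + int i + 1)"
proof (induction i)
  case 0
  have G: "hgens [0] (emb ` J) (shifts R 0) (columns R 0)" using R[unfolded minimal_resolution_iff] by blast
  have le: "\<forall>e\<in>set (shifts R 0). e \<le> d"
    by (rule min_gens_degree_le[OF J G min_syz_columns[OF R]])
  then show ?case using graded_submodule_syz[OF G] tor_bound_syz[OF G le J(2)] by simp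
next
  case (Suc i)
  have G: "hgens (shifts R i) (syz (shifts R i) (columns R i)) (shifts R (Suc i)) (columns R (Suc i))"
    using R[unfolded minimal_resolution_iff] by blast
  have N: "graded_submodule (shifts R i) (syz (shifts R i) (columns R i))"
    "tor_bound (shifts R i) (syz (shifts R i) (columns R i)) (d + int i + 1)" using Suc by auto
  have le: "\<forall>e\<in>set (shifts R (Suc i)). e \<le> d + int i + 1"
    by (rule min_gens_degree_le[OF N G min_syz_columns[OF R]])
  from tor_bound_syz[OF G le N(2)]
  have "tor_bound (shifts R (Suc i)) (syz (shifts R (Suc i)) (columns R (Suc i))) (d + int (Suc i) + 1)"
    by (simp add: ac_simps)
  moreover have "\<forall>e\<in>set (shifts R (Suc i)). e \<le> d + int (Suc i)" using le by (simp add: ac_simps)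
  ultimately show ?case using graded_submodule_syz[OF G] by blast
qed

text \<open>A column of the differential is nonzero, as otherwise a basis vector would be a syzygy
  with constant term 1. A nonzero entry lacks a constant term and so has positive degree. The
  resulting lower bound on shifts makes the set under \<open>Max\<close> finite.\<close>

lemma shifts_increase:
  fixes R :: "('v::finite, 'k::field, ('v, 'k) mpoly) graded_complex"
  assumes R: "minimal_graded_free_resolution (*) J (grading J) R" and e: "e \<in> set (shifts R (Suc i))"
  shows "\<exists>e'\<in>set (shifts R i). e' < e"
proof -
  obtain k where k: "k < length (shifts R (Suc i))" "e = shifts R (Suc i) ! k"
    using e by (auto simp: in_set_conv_nth)
  have D: "is_graded_complex (grading J) R" using R unfolding minimal_resolution_iff by blast
  have dim: "dim_row (differential R i) = length (shifts R i)" "dim_col (differential R i) = length (shifts R (Suc i))"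
    using graded_complexD(4)[OF D, of i] by auto
  have min: "Poly_Mapping.lookup (differential R i $$ (l, k)) 0 = 0" if "l < length (shifts R i)" for l
    using R that k(1) unfolding minimal_resolution_iff by blast
  let ?u = "\<lambda>l. if l = k then 1 else 0 :: ('v, 'k) mpoly"
  have "columns R (Suc i) ! k \<noteq> 0"
  proof
    assume "columns R (Suc i) ! k = 0"
    moreover have "comb (columns R (Suc i)) ?u = columns R (Suc i) ! k"
      by (rule comb_unit) (simp add: length_fcols dim k)
    ultimately have "?u \<in> syz (shifts R (Suc i)) (columns R (Suc i))"
      using unit_in_free[OF k(1)] by (simp only: syz_def mem_Collect_eq)
    from min_syz_columns[OF R, of "Suc i", unfolded min_syz_def, THEN bspec, OF this, THEN spec, of k]
    show False by simp
  qed
  then obtain l where "(columns R (Suc i) ! k) l \<noteq> 0" by (auto simp: fun_eq_iff)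
  then have l: "l < length (shifts R i)" "differential R i $$ (l, k) \<noteq> 0"
    using k(1) dim by (auto simp: nth_fcols split: if_splits)
  then obtain m where m: "m \<in> Poly_Mapping.keys (differential R i $$ (l, k))"
    by (metis ex_in_conv keys_eq_empty)
  have "int (mon_degree m) = e - shifts R i ! l"
    using graded_complexD(5)[OF D l(1) k(1)] m k(2) by (simp add: homogeneous_def)
  moreover have "m \<noteq> 0" using m min[OF l(1)] by (auto simp: in_keys_iff)
  then have "mon_degree m > 0" using mon_degree_eq_0[of m] by linarith
  ultimately have "shifts R i ! l < e" by linarith
  then show ?thesis using l(1) by auto
qed

text \<open>Generators are chosen step by step. The Tor bound must be carried along in
  \<open>P\<close>, because it is what yields finitely many generators for the next
  syzygies.\<close>

lemma exists_minimal_resolution: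
  fixes J :: "('v::finite, 'k::field) mpoly set"
  assumes J: "graded_submodule [0] (emb ` J)" "tor_bound [0] (emb ` J) d"
  shows "\<exists>R. minimal_graded_free_resolution (*) J (grading J) R"
proof -
  define P where "P = (\<lambda>i (es, G :: ('v, 'k) fvec list). graded_submodule es (syz es G) \<and> min_syz es G \<and>
    tor_bound es (syz es G) (d + int i + 1) \<and> (i = 0 \<longrightarrow> hgens [0] (emb ` J) es G))"
  define Q where "Q = (\<lambda>(i::nat) (es, G :: ('v, 'k) fvec list) (es', G'). hgens es (syz es G) es' G')"
  have "\<exists>x. P 0 x"
  proof -
    obtain es G where G: "hgens [0] (emb ` J) es G" "min_syz es G" using exists_min_gens[OF J] by blast
    have "P 0 (es, G)"
      using graded_submodule_syz[OF G(1)] G tor_bound_syz[OF G(1) min_gens_degree_le[OF J G] J(2)]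
      by (simp add: P_def)
    then show ?thesis by blast
  qed
  moreover have "\<exists>y. P (Suc i) y \<and> Q i x y" if "P i x" for i x
  proof -
    obtain es G where x: "x = (es, G)" by (cases x)
    have N: "graded_submodule es (syz es G)" "tor_bound es (syz es G) (d + int i + 1)"
      using that by (auto simp: P_def x)
    obtain es' G' where G: "hgens es (syz es G) es' G'" "min_syz es' G'" using exists_min_gens[OF N] by blast
    have "tor_bound es' (syz es' G') (d + int (Suc i) + 1)"
      using tor_bound_syz[OF G(1) min_gens_degree_le[OF N G] N(2)] by (simp add: ac_simps)
    then have "P (Suc i) (es', G') \<and> Q i x (es', G')"
      using graded_submodule_syz[OF G(1)] G by (simp add: P_def Q_def x)
    then show ?thesis by blast
  qed
  ultimately obtain s where s: "\<And>i. P i (s i)" "\<And>i. Q i (s i) (s (Suc i))"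
    using dependent_nat_choice[of P Q] by blast
  define es where "es = (\<lambda>i. fst (s i))"
  define G where "G = (\<lambda>i. snd (s i))"
  have se: "s i = (es i, G i)" for i by (simp add: es_def G_def)
  have G0: "hgens [0] (emb ` J) (es 0) (G 0)" using s(1)[of 0] by (simp add: P_def se)
  have GS: "hgens (es i) (syz (es i) (G i)) (es (Suc i)) (G (Suc i))" for i using s(2)[of i] by (simp add: Q_def se)
  have min: "min_syz (es i) (G i)" for i using s(1)[of i] by (simp add: P_def se)
  define R where "R = \<lparr>shifts = es, gens = map (\<lambda>g. g 0) (G 0),
    differential = (\<lambda>i. mat (length (es i)) (length (es (Suc i))) (\<lambda>(l, k). (G (Suc i) ! k) l))\<rparr>"
  have R: "shifts R = es" "gens R = map (\<lambda>g. g 0) (G 0)"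
    "differential R i = mat (length (es i)) (length (es (Suc i))) (\<lambda>(l, k). (G (Suc i) ! k) l)" for i
    by (simp_all add: R_def)
  \<comment> \<open>Entries beyond the rank are zero, so passing from functions to matrices and back
    loses nothing.\<close>
  have free: "G 0 ! k \<in> free [0]" if "k < length (es 0)" for k
    using hgensD(2)[OF G0 that] by (simp add: hvec_def)
  have freeS: "G (Suc i) ! k \<in> free (es i)" if "k < length (es (Suc i))" for i k
    using hgensD(2)[OF GS that] by (simp add: hvec_def)
  have "columns R i = G i" for i
  proof (cases i)
    case 0
    show ?thesis
      unfolding 0 columns.simps R
    proof (rule nth_equalityI)
      fix k assume "k < length (map emb (map (\<lambda>g. g 0) (G 0)))"
      then have "k < length (G 0)" by simp
      then show "map emb (map (\<lambda>g. g 0) (G 0)) ! k = G 0 ! k"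
        using free[of k] hgensD(1)[OF G0] by (simp add: emb_apply_0)
    qed simp
  next
    case (Suc j)
    show ?thesis
      unfolding Suc columns.simps R
    proof (rule nth_equalityI)
      show "length (fcols (mat (length (es j)) (length (es (Suc j))) (\<lambda>(l, k). (G (Suc j) ! k) l))) = length (G (Suc j))"
        using hgensD(1)[OF GS[of j]] by (simp add: length_fcols)
      fix k assume "k < length (fcols (mat (length (es j)) (length (es (Suc j))) (\<lambda>(l, k). (G (Suc j) ! k) l)))"
      then have k: "k < length (es (Suc j))" by (simp add: length_fcols)
      show "fcols (mat (length (es j)) (length (es (Suc j))) (\<lambda>(l, k). (G (Suc j) ! k) l)) ! k = G (Suc j) ! k"
        using freeS[OF k] k by (auto simp: nth_fcols fun_eq_iff free_def)
    qed
  qed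
  note cols = this
  have "is_graded_complex (grading J) R"
    unfolding is_graded_complex_def R
  proof (intro conjI allI impI)
    show "length (map (\<lambda>g. g 0) (G 0)) = length (es 0)" using hgensD(1)[OF G0] by simp
    show "map (\<lambda>g. g 0) (G 0) ! l \<in> grading J (es 0 ! l)" if "l < length (map (\<lambda>g. g 0) (G 0))" for l
    proof -
      have l: "l < length (es 0)" using that hgensD(1)[OF G0] by simp
      obtain f where f: "f \<in> J" "G 0 ! l = emb f" using hgensD(3)[OF G0 l] by blast
      then have "homogeneous (es 0 ! l) f" using hgensD(2)[OF G0 l] by (simp add: hvec_emb)
      then show ?thesis using f that by (simp add: grading_def emb_def)
    qed
    fix i
    show "mat (length (es i)) (length (es (Suc i))) (\<lambda>(l, k). (G (Suc i) ! k) l) \<in> carrier_mat (length (es i)) (length (es (Suc i)))"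
      by simp
    show "homogeneous (es (Suc i) ! k - es i ! l) (mat (length (es i)) (length (es (Suc i))) (\<lambda>(l, k). (G (Suc i) ! k) l) $$ (l, k))"
      if "l < length (es i)" "k < length (es (Suc i))" for l k
      using hgensD(2)[OF GS that(2)] that by (simp add: hvec_def)
  qed
  moreover have "Poly_Mapping.lookup (differential R i $$ (l, k)) 0 = 0"
    if "l < length (shifts R i)" "k < length (shifts R (Suc i))" for i l k
  proof -
    have "G (Suc i) ! k \<in> syz (es i) (G i)" using hgensD(3)[OF GS] that by (simp add: R)
    then show ?thesis using min[of i] that by (simp add: R min_syz_def)
  qed
  ultimately have "minimal_graded_free_resolution (*) J (grading J) R"
    unfolding minimal_resolution_iff cols using G0 GS by (simp add: R(1))
  then show ?thesis by blast
qed

text \<open>The bound holds in every minimal resolution and such a resolution exists, hence it holds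
  in the one picked by \<open>SOME\<close>.\<close>

lemma ideal_reg_le:
  fixes U :: "('v::finite \<Rightarrow>\<^sub>0 nat) set"
  assumes U: "up_closed U" "U \<noteq> {}"
    and acyc: "\<And>i a. int i + d < int (mon_degree a) \<Longrightarrow> acyclic_at TYPE('k::field) {A. \<exists>m\<in>U. a = m + ind A} i"
  shows "ideal_reg (monomial_span U :: ('v, 'k) mpoly set) \<le> d"
proof -
  let ?J = "monomial_span U :: ('v, 'k) mpoly set"
  have "exact_at (\<lambda>z f. Var z * f) (grading ?J) i j" if "int i + d < j" for i j
  proof -
    have "exact_at (\<lambda>z f. Var z * f) (\<lambda>j. {f :: ('v, 'k) mpoly. Poly_Mapping.keys f \<subseteq> U \<and> homogeneous j f}) i j"
      using that by (intro exact_at_monomial acyc) simp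
    moreover have "(\<lambda>j. {f :: ('v, 'k) mpoly. Poly_Mapping.keys f \<subseteq> U \<and> homogeneous j f}) = grading ?J"
      by (simp add: grading_def monomial_span_def fun_eq_iff)
    ultimately show ?thesis by simp
  qed
  then have J: "graded_submodule [0] (emb ` ?J)" "tor_bound [0] (emb ` ?J) d"
    using graded_submodule_emb[OF U(1)] tor_bound_emb by blast+
  define R where "R = (SOME R. minimal_graded_free_resolution (*) ?J (grading ?J) R)"
  have R: "minimal_graded_free_resolution (*) ?J (grading ?J) R"
    unfolding R_def by (rule someI_ex) (rule exists_minimal_resolution[OF J])
  let ?S = "{j - int i | i j. graded_betti (*) ?J (grading ?J) i j \<noteq> 0}"
  have S: "?S = {j - int i | i j. j \<in> set (shifts R i)}"
    unfolding graded_betti_def R_def[symmetric] count_list_0_iff by simp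
  have up: "j \<le> d + int i" if "j \<in> set (shifts R i)" for i j
    using tor_bound_resolution[OF R J, of i] that by blast
  \<comment> \<open>The least shift at step 0, or 0 if smaller. By \<open>shifts_increase\<close> no
    difference \<open>j - int i\<close> falls below it.\<close>
  define e0 where "e0 = Min (insert 0 (set (shifts R 0)))"
  have low: "e0 + int i \<le> j" if "j \<in> set (shifts R i)" for i j
    using that
  proof (induction i arbitrary: j)
    case 0
    then show ?case by (simp add: e0_def)
  next
    case (Suc i)
    obtain e' where "e' \<in> set (shifts R i)" "e' < j" using shifts_increase[OF R Suc.prems] by blast
    then show ?case using Suc.IH[of e'] by simp
  qed
  have sub: "?S \<subseteq> {e0..d}"
  proof
    fix r assume "r \<in> ?S"
    then obtain i j where "r = j - int i" "j \<in> set (shifts R i)" unfolding S by auto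
    then show "r \<in> {e0..d}" using low[of j i] up[of j i] by simp
  qed
  then have "finite ?S" by (rule finite_subset) (rule finite_atLeastAtMost_int)
  \<comment> \<open>\<open>Max\<close> is unspecified on the empty set. The ideal is nonzero, so
    \<open>F_0\<close> has a basis vector.\<close>
  moreover have "?S \<noteq> {}"
  proof -
    have G: "hgens [0] (emb ` ?J) (shifts R 0) (columns R 0)" using R unfolding minimal_resolution_iff by blast
    obtain m where "m \<in> U" using U(2) by blast
    then have "emb (Poly_Mapping.single m 1) \<in> emb ` ?J" by (intro imageI) (simp add: monomial_span_def)
    then obtain v where v: "emb (Poly_Mapping.single m 1 :: ('v, 'k) mpoly) = comb (columns R 0) v"
      using hgensD(4)[OF G] by blast
    have "shifts R 0 \<noteq> []"
    proof
      assume "shifts R 0 = []"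
      then have "columns R 0 = []" using hgensD(1)[OF G] by (simp del: columns.simps)
      then have "comb (columns R 0) v = 0" by (simp add: comb_def)
      then have "emb (Poly_Mapping.single m 1 :: ('v, 'k) mpoly) = 0" using v by simp
      then have "Poly_Mapping.single m 1 = (0 :: ('v, 'k) mpoly)" by (simp only: emb_eq_0_iff)
      then show False by (metis lookup_single_eq lookup_zero zero_neq_one)
    qed
    then obtain j where "j \<in> set (shifts R 0)" by (meson hd_in_set)
    then have "j - int 0 \<in> ?S" unfolding S by blast
    then show ?thesis by blast
  qed
  ultimately have "Max ?S \<in> ?S" by (rule Max_in)
  then have "Max ?S \<le> d" using subsetD[OF sub] by (simp only: atLeastAtMost_iff)
  moreover have "ideal_reg ?J = Max ?S"
    unfolding ideal_reg_def regularity_def grading_def[abs_def] ..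
  ultimately show ?thesis by simp
qed

text \<open>Subsets of a maximum matching are matchings, so every size up to the matching number
  occurs. This makes the squarefree power a nonzero ideal.\<close>

lemma matching_monomials_nonempty:
  assumes "s \<le> matching_number E"
  shows "matching_monomials E s \<noteq> {}"
proof -
  let ?C = "{card M | M. matching E M}"
  have "?C \<subseteq> {..card E}" by (auto simp: matching_def intro!: card_mono)
  then have "finite ?C" by (rule finite_subset) simp
  moreover have "matching E {}" by (simp add: matching_def)
  then have "?C \<noteq> {}" by blast
  ultimately have "matching_number E \<in> ?C" unfolding matching_number_def by (rule Max_in)
  then obtain M where M: "matching E M" "card M = matching_number E" by auto
  then obtain M' where M': "M' \<subseteq> M" "card M' = s" using assms obtain_subset_with_card_n by metis
  have "matching E M'"
    using M(1) M'(1) unfolding matching_def by (meson pairwise_subset subset_trans)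
  \<comment> \<open>The support of \<open>ind UNIV\<close> is the whole vertex set, so it contains
    any matching.\<close>
  then have "ind UNIV \<in> matching_monomials E s" using M'(2) by (auto simp: matching_monomials_def keys_ind)
  then show ?thesis by blast
qed

lemma ideal_reg_squarefree_power_le:
  fixes E :: "'v::finite set set"
  assumes "simple_graph E" "bipartition E X Y" "s \<le> matching_number E"
  shows "ideal_reg (squarefree_power (edge_ideal E :: ('v, 'k::field) mpoly set) s) \<le> int (card X + s)"
  unfolding squarefree_power_eq[OF assms(1)]
proof (rule ideal_reg_le[OF up_closed_matching_monomials matching_monomials_nonempty[OF assms(3)]])
  fix i and a :: "'v \<Rightarrow>\<^sub>0 nat" assume "int i + int (card X + s) < int (mon_degree a)"
  moreover have "X \<union> Y = UNIV" "X \<inter> Y = {}" using assms(2) by (auto simp: bipartition_def)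
  ultimately show "acyclic_at TYPE('k) {A. \<exists>m\<in>matching_monomials E s. a = m + ind A} i"
    unfolding matching_monomials_bipartite[OF assms(2)] by (intro acyclic_at_matching_monomials) auto
qed

theorem theorem3p9:
  fixes E :: "'v::finite set set" and X Y :: "'v set" and s :: nat
  assumes "simple_graph E"
    and "bipartition E X Y"
    and "1 \<le> s" and "s \<le> matching_number E"
  shows "ideal_reg (squarefree_power (edge_ideal E :: ('v, 'k::field) mpoly set) s)
           \<le> int (min (card X) (card Y) + s)"
proof -
  \<comment> \<open>The one-sided bound counts the class named first, so the bipartition is used in
    both orders.\<close>
  have swap: "bipartition E Y X"
    unfolding bipartition_def
  proof (intro conjI ballI)
    show "Y \<union> X = UNIV" "Y \<inter> X = {}" using assms(2) by (auto simp: bipartition_def)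
    have edges: "\<forall>e\<in>E. \<exists>x\<in>X. \<exists>y\<in>Y. e = {x, y}" using assms(2) unfolding bipartition_def by (elim conjE)
    fix e assume "e \<in> E"
    from bspec[OF edges this] obtain x y where "x \<in> X" "y \<in> Y" "e = {x, y}" by (elim bexE)
    then show "\<exists>y\<in>Y. \<exists>x\<in>X. e = {y, x}" by (intro bexI[of _ y] bexI[of _ x]) auto
  qed
  show ?thesis
    using ideal_reg_squarefree_power_le[OF assms(1,2,4), where 'k = 'k]
      ideal_reg_squarefree_power_le[OF assms(1) swap assms(4), where 'k = 'k]
    by (simp add: min_def)
qed

end
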